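(* Let $H\le F_m$ be a non-cyclic free factor whose Whitehead graph contains a cut vertex, and let $\varphi=(A,a)$, $S$, $Q$ and the automaton $\mathcal{B}$ be as in the context. Let $M$ be the adjacency matrix of the automaton $\mathcal{B}_H$, and let $M_1$ be the $|Q|\times|Q|$ matrix obtained from $M$ by the following procedure. For each $(s,a^{\epsilon})\in S$: take the associated row $R_{(s,a^\epsilon)}$ and column $C_{(s,a^\epsilon)}$ of $M$; locate all nonzero entries (necessarily equal to $1$) of $C_{(s,a^\epsilon)}$, lying in rows $R_{o(e_1)},\dots,R_{o(e_d)}$; replace each row $R_{o(e_i)}$, $i=1,\dots,d$, by $R_{o(e_i)}+R_{(s,a^\epsilon)}$; then delete the row $R_{(s,a^\epsilon)}$ and the column $C_{(s,a^\epsilon)}$. Repeat this for every element of $S$. Then $M_1$ is the adjacency matrix of the transition diagram of $\mathcal{B}$, which is isomorphic to $\mathcal{B}_{\varphi(H)}$.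
   Context: Free group and words. $F_m$ is the free group of finite rank $m>2$ with fixed basis $X=\{x_1,\dots,x_m\}$, and $\Sigma=X\cup X^{-1}$. A word $y_1\cdots y_n$ over $\Sigma$ is reduced if $y_{i+1}\ne y_i^{-1}$ for all $i$, and cyclically reduced if moreover $y_n\ne y_1^{-1}$. Standing assumption: $H$ is a non-trivial, non-cyclic finitely generated subgroup generated by cyclically reduced words. Core. For a finitely generated $K\le F_m$, the Schreier graph has the right cosets $Kg$ as vertices and, for each coset and each $x\in X$, an edge labeled $x$ from $Kg$ to $Kgx$; its root is $v_1=K$. The core $\Delta_K$ is the subgraph that is the union of the reduced closed paths based at $v_1$ (edges may be traversed backwards, reading the inverse letter). The extended core $\widehat\Delta_K$ has the same vertices and, for each edge $e$ of $\Delta_K$ labeled $x$, both $e$ and an inverse edge $\bar e$ labeled $x^{-1}$ from the terminus of $e$ to its origin. $L_v\subseteq\Sigma$ is the set of labels of edges of $\widehat\Delta_K$ with origin $v$; for $z\in L_v$, $vz$ is the terminus of that edge. Automaton $\mathcal{B}_K$. Its state set $Q_K$ consists of the pairs $(v,y)$, with $v$ a vertex of $\widehat\Delta_K$ and $y\in\Sigma$, such that some edge of $\widehat\Delta_K$ labeled $y$ terminates at $v$. From $(v,y)$ there is an edge labeled $z$ to $(vz,z)$ for every $z\in L_v$, $z\ne y^{-1}$. Both the initial and the final states form the set $I_K$ of all states $(v_1,y)$. The adjacency matrix is that of the transition diagram: its $(p,r)$ entry is the number of edges from $p$ to $r$. Whitehead graph. The Whitehead graph of $H$ is the undirected graph with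 vertex set $\Sigma$ and, for every vertex $v$ of $\Delta_H$ and every pair of distinct letters of $L_v$, an edge between these letters. A vertex $a$ of it is a cut vertex if it is non-isolated and either the connected component of $a$ does not contain $a^{-1}$, or the connected component of $a$ becomes disconnected when $a$ is removed. Whitehead automorphism. For $a\in\Sigma$ and $A\subseteq\Sigma\setminus\{a,a^{-1}\}$, $\varphi=(A,a)$ is the automorphism of $F_m$ with $a\mapsto a$ and, for the other generators, $x_j\mapsto x_j$ if $x_j,x_j^{-1}\notin A$; $x_j\mapsto ax_j$ if $x_j\in A$, $x_j^{-1}\notin A$; $x_j\mapsto x_ja^{-1}$ if $x_j\notin A$, $x_j^{-1}\in A$; $x_j\mapsto ax_ja^{-1}$ if $x_j,x_j^{-1}\in A$. The automorphism $\varphi$. If $H$ is a free factor whose Whitehead graph contains a cut vertex, a theorem of Ascari gives a Whitehead automorphism $\varphi=(A,a)$ such that $\Delta_{\varphi(H)}$ has strictly fewer vertices and strictly fewer edges than $\Delta_H$, chosen so that at each vertex $v$ of $\Delta_H$ exactly one of the following holds: $L_v\cap A=\emptyset$; $L_v\subseteq A$; or $a\in L_v$ and $L_v\subseteq A\cup\{a\}$. Here $\varphi$ is this automorphism. Let $S_o$ be the set of vertices of the third kind and $S_t$ the set of termini of the edges labeled $a$ with origin in $S_o$. The automaton $\mathcal{B}$. Put $S=\{(v,a^{-1}):v\in S_o\}\cup\{(v',a):v'\in S_t\}\subset Q_H$ and $Q=Q_H\setminus S$. $\mathcal{B}$ is obtained from $\mathcal{B}_H$ by collapsing the edges terminating at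 states of $S$: its state set is $Q$; its edges are the edges of $\mathcal{B}_H$ with both ends in $Q$ and, for each $\sigma\in S$, each edge $p\to\sigma$ and each edge $\sigma\to r$ labeled $z$ of $\mathcal{B}_H$, an edge $p\to r$ labeled $z$; its initial states, equal to its final states, are obtained from $I_H$ by replacing each $\sigma\in I_H\cap S$ by the origins $p$ of the edges $p\to\sigma$ of $\mathcal{B}_H$. In the procedure, $e_1,\dots,e_d$ are the edges of $\mathcal{B}_H$ terminating at $(s,a^\epsilon)$ and $o(e_i)$ is the origin of $e_i$. The rows and columns of $M$ are indexed so that the states of $Q$ precede those of $S$.
   Formalization: B ≅ B_{φ(H)} fails if L_{v_1} meets A (e.g. H=<ayx^-1, xa^-1za^-1>, A={x,z}: 6 vs 8 states). It is proved if L_{v_1}∩A=∅ or φ(H) meets the standing assumption; otherwise B is shown isomorphic to the automaton of a^-1 φ(H) a. The matrix claim is unchanged. *)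

theory Defs
  imports "HOL-Algebra.Elementary_Groups" "Jordan_Normal_Form.Determinant"
begin

section \<open>The free group on a type of generators\<close>

text \<open>
  The letter \<open>(x, True)\<close> is the generator \<open>x\<close> and \<open>(x, False)\<close> is its inverse. The basis is
  the whole type \<open>'x\<close>, so for a finite type the rank is \<open>CARD('x)\<close>.
\<close>

type_synonym 'x letter = "'x \<times> bool"
type_synonym 'x word = "'x letter list"

definition inv_letter :: "'x letter \<Rightarrow> 'x letter" where
  "inv_letter y = (fst y, \<not> snd y)"

definition reduced :: "'x word \<Rightarrow> bool" where
  "reduced w \<longleftrightarrow> successively (\<lambda>y z. z \<noteq> inv_letter y) w"

definition cyclically_reduced :: "'x word \<Rightarrow> bool" where
  "cyclically_reduced w \<longleftrightarrow> reduced w \<and> (w \<noteq> [] \<longrightarrow> last w \<noteq> inv_letter (hd w))"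

text \<open>\<open>push y w\<close> is the reduced form of \<open>y # w\<close> when \<open>w\<close> is reduced.\<close>

fun push :: "'x letter \<Rightarrow> 'x word \<Rightarrow> 'x word" where
  "push y [] = [y]"
| "push y (z # w) = (if z = inv_letter y then w else y # z # w)"

definition reduce :: "'x word \<Rightarrow> 'x word" where
  "reduce w = foldr push w []"

definition free_group :: "'x word monoid" where
  "free_group = \<lparr>carrier = {w. reduced w}, monoid.mult = (\<lambda>u v. reduce (u @ v)), one = []\<rparr>"

definition generated_by_cyclically_reduced :: "'x word set \<Rightarrow> bool" where
  "generated_by_cyclically_reduced K \<longleftrightarrow>
     (\<exists>Y. finite Y \<and> (\<forall>w\<in>Y. cyclically_reduced w) \<and> K = generate free_group Y)"

definition standing_assumption :: "'x word set \<Rightarrow> bool" where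
  "standing_assumption K \<longleftrightarrow>
     subgroup K free_group \<and> K \<noteq> {\<one>\<^bsub>free_group\<^esub>} \<and>
     \<not> cyclic_group (subgroup_generated free_group K) \<and>
     generated_by_cyclically_reduced K"

text \<open>
  \<open>H\<close> is a free factor if the free group is an internal free product of \<open>H\<close> and some subgroup
  \<open>K\<close>: together they generate, and no nonempty alternating product of nontrivial elements of
  \<open>H\<close> and \<open>K\<close> is trivial. The Boolean tag says from which factor a syllable is taken, so that
  the condition also forces \<open>H\<close> and \<open>K\<close> to intersect trivially.
\<close>

definition free_factor :: "'x word set \<Rightarrow> bool" where
  "free_factor H \<longleftrightarrow>
     subgroup H free_group \<and>
     (\<exists>K. subgroup K free_group \<and>
          generate free_group (H \<union> K) = carrier free_group \<and>
          (\<forall>ws :: (bool \<times> 'x word) list.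
             ws \<noteq> [] \<and> distinct_adj (map fst ws) \<and>
             (\<forall>(b, g) \<in> set ws. g \<in> (if b then H else K) \<and> g \<noteq> \<one>\<^bsub>free_group\<^esub>)
             \<longrightarrow> foldr (\<lambda>(b, g) u. g \<otimes>\<^bsub>free_group\<^esub> u) ws \<one>\<^bsub>free_group\<^esub> \<noteq> \<one>\<^bsub>free_group\<^esub>))"


section \<open>Core of the Schreier graph\<close>

text \<open>An edge \<open>(u, x, v)\<close> has origin \<open>u\<close>, label \<open>x\<close> and terminus \<open>v\<close>.\<close>

record ('v, 'l) lgraph =
  verts :: "'v set"
  edges :: "('v \<times> 'l \<times> 'v) set"

type_synonym 'x coset = "'x word set"

definition schreier_edges :: "'x word set \<Rightarrow> ('x coset \<times> 'x \<times> 'x coset) set" where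
  "schreier_edges K =
     {(V, x, V #>\<^bsub>free_group\<^esub> [(x, True)]) | V x. V \<in> rcosets\<^bsub>free_group\<^esub> K}"

text \<open>The edges of a graph labeled by generators, together with their inverse edges.\<close>

definition sym_edges :: "('v \<times> 'x \<times> 'v) set \<Rightarrow> ('v \<times> 'x letter \<times> 'v) set" where
  "sym_edges E = {(u, (x, True), v) | u x v. (u, x, v) \<in> E} \<union>
                 {(v, (x, False), u) | u x v. (u, x, v) \<in> E}"

definition inverse_edge :: "'v \<times> 'x letter \<times> 'v \<Rightarrow> 'v \<times> 'x letter \<times> 'v" where
  "inverse_edge = (\<lambda>(u, y, v). (v, inv_letter y, u))"

fun is_path :: "('v \<times> 'l \<times> 'v) set \<Rightarrow> 'v \<Rightarrow> ('v \<times> 'l \<times> 'v) list \<Rightarrow> 'v \<Rightarrow> bool" where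
  "is_path E u [] v \<longleftrightarrow> u = v"
| "is_path E u (e # es) v \<longleftrightarrow> e \<in> E \<and> fst e = u \<and> is_path E (snd (snd e)) es v"

definition reduced_closed_path ::
    "('v \<times> 'x \<times> 'v) set \<Rightarrow> 'v \<Rightarrow> ('v \<times> 'x letter \<times> 'v) list \<Rightarrow> bool" where
  "reduced_closed_path E v es \<longleftrightarrow>
     is_path (sym_edges E) v es v \<and> successively (\<lambda>e e'. e' \<noteq> inverse_edge e) es"

definition core_edges :: "'x word set \<Rightarrow> ('x coset \<times> 'x \<times> 'x coset) set" where
  "core_edges K =
     {(u, x, v) \<in> schreier_edges K.
        \<exists>es. reduced_closed_path (schreier_edges K) K es \<and>
             ((u, (x, True), v) \<in> set es \<or> (v, (x, False), u) \<in> set es)}"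

text \<open>The root is the coset \<open>K\<close> itself; it belongs to the core because of the empty path.\<close>

definition core :: "'x word set \<Rightarrow> ('x coset, 'x) lgraph" where
  "core K = \<lparr>verts = insert K (\<Union>(u, x, v) \<in> core_edges K. {u, v}), edges = core_edges K\<rparr>"

definition extended_core :: "'x word set \<Rightarrow> ('x coset, 'x letter) lgraph" where
  "extended_core K = \<lparr>verts = verts (core K), edges = sym_edges (edges (core K))\<rparr>"

definition labels_at :: "'x word set \<Rightarrow> 'x coset \<Rightarrow> 'x letter set" where
  "labels_at K v = {z. \<exists>w. (v, z, w) \<in> edges (extended_core K)}"


section \<open>Automata\<close>

text \<open>
  The transitions form a set of triples: in all automata below a transition is determined by
  its origin, label and terminus.
\<close>

record ('s, 'l) automaton =
  states :: "'s set"
  transitions :: "('s \<times> 'l \<times> 's) set"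
  initial :: "'s set"
  final :: "'s set"

definition automaton_iso ::
    "('s, 'l) automaton \<Rightarrow> ('t, 'l) automaton \<Rightarrow> bool" where
  "automaton_iso B C \<longleftrightarrow>
     (\<exists>f. bij_betw f (states B) (states C) \<and>
          (\<lambda>(p, z, r). (f p, z, f r)) ` transitions B = transitions C \<and>
          f ` initial B = initial C \<and> f ` final B = final C)"

type_synonym 'x state = "'x coset \<times> 'x letter"

definition aut_states :: "'x word set \<Rightarrow> 'x state set" where
  "aut_states K = {(v, y). v \<in> verts (extended_core K) \<and> (\<exists>u. (u, y, v) \<in> edges (extended_core K))}"

definition aut :: "'x word set \<Rightarrow> ('x state, 'x letter) automaton" where
  "aut K =
     \<lparr>states = aut_states K,
      transitions = {((v, y), z, (w, z)) | v y z w. (v, y) \<in> aut_states K \<and>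
                       (v, z, w) \<in> edges (extended_core K) \<and> z \<noteq> inv_letter y},
      initial = {(v, y) \<in> aut_states K. v = K},
      final = {(v, y) \<in> aut_states K. v = K}\<rparr>"


section \<open>Whitehead graph and Whitehead automorphisms\<close>

text \<open>
  An edge is recorded as the unordered pair of its ends, tagged with the vertex of the core
  it comes from.
\<close>

definition whitehead_edges :: "'x word set \<Rightarrow> ('x coset \<times> 'x letter set) set" where
  "whitehead_edges H =
     {(v, {y, z}) | v y z. v \<in> verts (core H) \<and> y \<in> labels_at H v \<and> z \<in> labels_at H v \<and> y \<noteq> z}"

definition whitehead_adj :: "'x word set \<Rightarrow> 'x letter rel" where
  "whitehead_adj H = {(y, z). \<exists>v. (v, {y, z}) \<in> whitehead_edges H}"

definition whitehead_component :: "'x word set \<Rightarrow> 'x letter \<Rightarrow> 'x letter set" where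
  "whitehead_component H b = (whitehead_adj H)\<^sup>* `` {b}"

definition cut_vertex :: "'x word set \<Rightarrow> 'x letter \<Rightarrow> bool" where
  "cut_vertex H b \<longleftrightarrow>
     (\<exists>z. (b, z) \<in> whitehead_adj H) \<and>
     (inv_letter b \<notin> whitehead_component H b \<or>
      (let C = whitehead_component H b - {b} in
        \<exists>y\<in>C. \<exists>z\<in>C. (y, z) \<notin> (whitehead_adj H \<inter> C \<times> C)\<^sup>*))"

definition whitehead_automorphism ::
    "'x letter set \<Rightarrow> 'x letter \<Rightarrow> ('x word \<Rightarrow> 'x word) \<Rightarrow> bool" where
  "whitehead_automorphism A a \<phi> \<longleftrightarrow>
     a \<notin> A \<and> inv_letter a \<notin> A \<and>
     \<phi> \<in> iso free_group free_group \<and>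
     \<phi> [a] = [a] \<and>
     (\<forall>x. x \<noteq> fst a \<longrightarrow>
        \<phi> [(x, True)] =
          (if (x, True) \<in> A then [a] else []) @ [(x, True)] @
          (if (x, False) \<in> A then [inv_letter a] else []))"

definition vertex_kind1 :: "'x word set \<Rightarrow> 'x letter set \<Rightarrow> 'x coset \<Rightarrow> bool" where
  "vertex_kind1 H A v \<longleftrightarrow> labels_at H v \<inter> A = {}"

definition vertex_kind2 :: "'x word set \<Rightarrow> 'x letter set \<Rightarrow> 'x coset \<Rightarrow> bool" where
  "vertex_kind2 H A v \<longleftrightarrow> labels_at H v \<subseteq> A"

definition vertex_kind3 :: "'x word set \<Rightarrow> 'x letter set \<Rightarrow> 'x letter \<Rightarrow> 'x coset \<Rightarrow> bool" where
  "vertex_kind3 H A a v \<longleftrightarrow> a \<in> labels_at H v \<and> labels_at H v \<subseteq> A \<union> {a}"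

definition ascari_automorphism ::
    "'x word set \<Rightarrow> 'x letter set \<Rightarrow> 'x letter \<Rightarrow> ('x word \<Rightarrow> 'x word) \<Rightarrow> bool" where
  "ascari_automorphism H A a \<phi> \<longleftrightarrow>
     whitehead_automorphism A a \<phi> \<and>
     card (verts (core (\<phi> ` H))) < card (verts (core H)) \<and>
     card (edges (core (\<phi> ` H))) < card (edges (core H)) \<and>
     (\<forall>v \<in> verts (core H).
        (vertex_kind1 H A v \<and> \<not> vertex_kind2 H A v \<and> \<not> vertex_kind3 H A a v) \<or>
        (\<not> vertex_kind1 H A v \<and> vertex_kind2 H A v \<and> \<not> vertex_kind3 H A a v) \<or>
        (\<not> vertex_kind1 H A v \<and> \<not> vertex_kind2 H A v \<and> vertex_kind3 H A a v))"


section \<open>The collapsed automaton\<close>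

definition S_o :: "'x word set \<Rightarrow> 'x letter set \<Rightarrow> 'x letter \<Rightarrow> 'x coset set" where
  "S_o H A a = {v \<in> verts (core H). vertex_kind3 H A a v}"

definition S_t :: "'x word set \<Rightarrow> 'x letter set \<Rightarrow> 'x letter \<Rightarrow> 'x coset set" where
  "S_t H A a = {w. \<exists>v \<in> S_o H A a. (v, a, w) \<in> edges (extended_core H)}"

definition collapsed_states :: "'x word set \<Rightarrow> 'x letter set \<Rightarrow> 'x letter \<Rightarrow> 'x state set" where
  "collapsed_states H A a =
     {(v, inv_letter a) | v. v \<in> S_o H A a} \<union> {(w, a) | w. w \<in> S_t H A a}"

definition collapse :: "('s, 'l) automaton \<Rightarrow> 's set \<Rightarrow> ('s, 'l) automaton" where
  "collapse B S =
     \<lparr>states = states B - S,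
      transitions =
        {(p, z, r) \<in> transitions B. p \<notin> S \<and> r \<notin> S} \<union>
        {(p, z, r) | p z r. \<exists>\<sigma>\<in>S. (\<exists>y. (p, y, \<sigma>) \<in> transitions B) \<and> (\<sigma>, z, r) \<in> transitions B},
      initial = (initial B - S) \<union> {p. \<exists>\<sigma> \<in> initial B \<inter> S. \<exists>y. (p, y, \<sigma>) \<in> transitions B},
      final = (final B - S) \<union> {p. \<exists>\<sigma> \<in> final B \<inter> S. \<exists>y. (p, y, \<sigma>) \<in> transitions B}\<rparr>"


section \<open>Adjacency matrices and the elimination procedure\<close>

text \<open>The list \<open>ps\<close> enumerates the states and thereby indexes the rows and columns.\<close>

definition adjacency_matrix :: "('s, 'l) automaton \<Rightarrow> 's list \<Rightarrow> nat mat" where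
  "adjacency_matrix B ps =
     mat (length ps) (length ps)
       (\<lambda>(i, j). card {e \<in> transitions B. fst e = ps ! i \<and> snd (snd e) = ps ! j})"

text \<open>
  Add row \<open>k\<close> to every row having a nonzero entry in column \<open>k\<close>, then delete row and column \<open>k\<close>.
\<close>

definition eliminate_index :: "nat \<Rightarrow> nat mat \<Rightarrow> nat mat" where
  "eliminate_index k N =
     mat_delete
       (mat (dim_row N) (dim_col N)
         (\<lambda>(i, j). if N $$ (i, k) \<noteq> 0 then N $$ (i, j) + N $$ (k, j) else N $$ (i, j)))
       k k"

text \<open>
  Eliminate the states in the first list one after the other, in that order. The second list
  enumerates the states which index the current matrix; \<open>length (takeWhile (\<lambda>p. p \<noteq> \<sigma>) ps)\<close> is
  the position of \<open>\<sigma>\<close> in it.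
\<close>

fun eliminate :: "'s list \<Rightarrow> 's list \<Rightarrow> nat mat \<Rightarrow> nat mat" where
  "eliminate [] ps N = N"
| "eliminate (\<sigma> # ts) ps N =
     eliminate ts (remove1 \<sigma> ps) (eliminate_index (length (takeWhile (\<lambda>p. p \<noteq> \<sigma>) ps)) N)"

text \<open>
  For \<open>\<phi>\<close> as above, the based core of \<open>\<phi> ` H\<close> has a root of degree one exactly when the root of the core of \<open>H\<close>
  is not of the first kind; its only edge is then labeled \<open>a\<close>. Such a \<open>\<phi> ` H\<close> is not generated
  by cyclically reduced words, and its automaton has states on this stem which the collapsed
  automaton lacks. Moving the root to the other end of the stem replaces \<open>\<phi> ` H\<close> by its
  conjugate below.
\<close>

definition conj_by :: "'x letter \<Rightarrow> 'x word set \<Rightarrow> 'x word set" where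
  "conj_by a K =
     (\<lambda>h. (inv\<^bsub>free_group\<^esub> [a] \<otimes>\<^bsub>free_group\<^esub> h) \<otimes>\<^bsub>free_group\<^esub> [a]) ` K"

end

theory Submission
  imports Defs
begin

text \<open>
  Through \<open>\<phi>\<close> the Schreier graph of \<open>\<phi> ` H\<close> has the vertices of that of \<open>H\<close> and the same
  \<open>a\<close>-edges, while every half-edge with label in \<open>A\<close> is slid along the \<open>a\<close>-edge at its origin. By
  the trichotomy of the vertex kinds, a vertex of the second kind merely moves along its \<open>a\<close>-edge,
  and a vertex \<open>v\<close> of the third kind is merged with \<open>v a\<close>. Hence the core of \<open>\<phi> ` H\<close>, with its
  stem at the root removed, is the core of \<open>H\<close> with the edges \<open>v \<rightarrow> v a\<close>, \<open>v \<in> S_o\<close>, folded. A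
  collapsed edge is never next to another one on a reduced path, and no letter labels
  non-collapsed edges at both of its ends. So reduced paths fold to reduced paths. The states in
  \<open>S\<close> are the collapsed edges, which gives the isomorphism. Adding the row of \<open>\<sigma>\<close> to the rows
  with a nonzero entry in its column counts the new edges \<open>p \<rightarrow> \<sigma> \<rightarrow> r\<close>. No entry then exceeds
  \<open>1\<close>, because a second route from \<open>p\<close> to \<open>r\<close> would force a collapsed loop or two adjacent
  collapsed edges.
\<close>

section \<open>The free group\<close>

lemma inv_letter_inv_letter [simp]: "inv_letter (inv_letter y) = y"
  by (simp add: inv_letter_def)

lemma inv_letter_neq [simp]: "inv_letter y \<noteq> y" "y \<noteq> inv_letter y"
  by (simp_all add: inv_letter_def prod_eq_iff)

lemma inv_letter_inject [simp]: "inv_letter y = inv_letter z \<longleftrightarrow> y = z"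
  by (metis inv_letter_inv_letter)

lemma reduced_Nil [simp]: "reduced []"
  and reduced_singleton [simp]: "reduced [y]"
  and reduced_Cons_Cons [simp]: "reduced (y # z # w) \<longleftrightarrow> z \<noteq> inv_letter y \<and> reduced (z # w)"
  by (simp_all add: reduced_def)

lemma reduced_tl: "reduced (y # w) \<Longrightarrow> reduced w"
  by (cases w) auto

lemma reduced_append_iff:
  "reduced (u @ w) \<longleftrightarrow>
     reduced u \<and> reduced w \<and> (u \<noteq> [] \<longrightarrow> w \<noteq> [] \<longrightarrow> hd w \<noteq> inv_letter (last u))"
  unfolding reduced_def by (auto simp: successively_append_iff)

lemma reduced_inverse: "reduced (rev (map inv_letter w)) \<longleftrightarrow> reduced w"
proof -
  have "(\<lambda>x y :: 'a letter. x \<noteq> inv_letter y) = (\<lambda>x y. y \<noteq> inv_letter x)"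
    by (metis inv_letter_inv_letter)
  from arg_cong[OF this, of "\<lambda>P. successively P w"] show ?thesis
    by (simp add: reduced_def successively_rev successively_map)
qed

lemma reduced_push: "reduced w \<Longrightarrow> reduced (push y w)"
  by (cases w) (auto dest: reduced_tl)

lemma push_push_inv: "reduced w \<Longrightarrow> push y (push (inv_letter y) w) = w"
proof (cases w)
  case (Cons z u)
  then show "reduced w \<Longrightarrow> push y (push (inv_letter y) w) = w"
    by (cases u) auto
qed simp

lemma reduce_Nil [simp]: "reduce [] = []"
  and reduce_Cons: "reduce (y # w) = push y (reduce w)"
  by (simp_all add: reduce_def)

lemma reduced_reduce [simp]: "reduced (reduce w)"
  by (induction w) (simp_all add: reduce_Cons reduced_push)

lemma reduce_reduced [simp]: "reduced w \<Longrightarrow> reduce w = w"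
proof (induction w)
  case (Cons y w)
  then show ?case
    by (cases w) (auto simp: reduce_Cons dest: reduced_tl)
qed simp

lemma reduce_append_reduce: "reduce (u @ reduce w) = reduce (u @ w)"
  by (induction u) (simp_all add: reduce_Cons)

lemma reduce_push_append: "reduced w \<Longrightarrow> reduce (push y w @ u) = push y (reduce (w @ u))"
proof (cases w)
  case (Cons z w')
  assume "reduced w"
  then show ?thesis
    using Cons by (auto simp: reduce_Cons push_push_inv)
qed (simp add: reduce_Cons)

text \<open>Together with \<open>reduce_append_reduce\<close> this gives associativity: reducing
  either factor first does not change the reduced form of a concatenation.\<close>

lemma reduce_reduce_append: "reduce (reduce u @ w) = reduce (u @ w)"
  by (induction u) (simp_all add: reduce_Cons reduce_push_append)

lemma reduce_inverse_append: "reduce (rev (map inv_letter w) @ w) = []"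
proof (induction w)
  case (Cons y w)
  have "reduce ([inv_letter y, y] @ w) = reduce w"
    using push_push_inv[of "reduce w" "inv_letter y"] by (simp add: reduce_Cons)
  then have "reduce (rev (map inv_letter w) @ [inv_letter y, y] @ w) = []"
    by (metis Cons reduce_append_reduce)
  then show ?case
    by simp
qed simp

abbreviation \<F> :: "'x word monoid" where
  "\<F> \<equiv> free_group"

lemma carrier_free_group [simp]: "w \<in> carrier \<F> \<longleftrightarrow> reduced w"
  and mult_free_group: "u \<otimes>\<^bsub>\<F>\<^esub> v = reduce (u @ v)"
  and one_free_group: "\<one>\<^bsub>\<F>\<^esub> = []"
  by (simp_all add: free_group_def)

lemma group_free_group: "group \<F>"
proof (rule groupI)
  fix w :: "'x word"
  assume "w \<in> carrier \<F>"
  then show "\<exists>v\<in>carrier \<F>. v \<otimes>\<^bsub>\<F>\<^esub> w = \<one>\<^bsub>\<F>\<^esub>"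
    by (intro bexI[of _ "rev (map inv_letter w)"])
      (simp_all add: mult_free_group one_free_group reduce_inverse_append reduced_inverse)
qed (auto simp: mult_free_group one_free_group reduce_append_reduce reduce_reduce_append)

interpretation FG: group "\<F> :: 'x word monoid"
  by (rule group_free_group)

lemma inv_singleton: "inv\<^bsub>\<F>\<^esub> [y] = [inv_letter y]"
  by (rule FG.inv_equality) (simp_all add: mult_free_group one_free_group reduce_Cons)

lemma singleton_mult_inv [simp]:
  "[y] \<otimes>\<^bsub>\<F>\<^esub> [inv_letter y] = []" "[inv_letter y] \<otimes>\<^bsub>\<F>\<^esub> [y] = []"
  by (simp_all add: mult_free_group reduce_Cons)

lemma reduce_Cons_mult: "reduce (y # w) = [y] \<otimes>\<^bsub>\<F>\<^esub> reduce w"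
  by (simp add: mult_free_group reduce_Cons)

lemma mult_Nil [simp]: "reduced w \<Longrightarrow> [] \<otimes>\<^bsub>\<F>\<^esub> w = w" "reduced w \<Longrightarrow> w \<otimes>\<^bsub>\<F>\<^esub> [] = w"
  by (simp_all add: mult_free_group)

section \<open>Folding a labelled graph\<close>

definition labels :: "('v \<times> 'l \<times> 'v) list \<Rightarrow> 'l list" where
  "labels es = map (fst \<circ> snd) es"

lemma labels_simps [simp]:
  "labels [] = []" "labels (e # es) = fst (snd e) # labels es"
  "labels (es @ es') = labels es @ labels es'" "labels es = [] \<longleftrightarrow> es = []"
  by (simp_all add: labels_def)

lemma is_path_append:
  "is_path E u (es @ es') w \<longleftrightarrow> (\<exists>v. is_path E u es v \<and> is_path E v es' w)"
  by (induction es arbitrary: u) auto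

lemma is_path_subset: "is_path E u es v \<Longrightarrow> set es \<subseteq> E"
  by (induction es arbitrary: u) auto

lemma is_path_mono: "is_path E u es v \<Longrightarrow> set es \<subseteq> E' \<Longrightarrow> is_path E' u es v"
  by (induction es arbitrary: u) auto

lemma inverse_edge_simp [simp]: "inverse_edge (u, y, v) = (v, inv_letter y, u)"
  by (simp add: inverse_edge_def)

lemma inverse_edge_inverse_edge [simp]: "inverse_edge (inverse_edge e) = e"
  by (cases e) simp

text \<open>In an involutive graph an edge is determined by its label and its terminus, so these
  pairs stand for the edges themselves, and a set of collapsed edges becomes a set of collapsed
  states.\<close>

definition edge_states :: "('v \<times> 'l \<times> 'v) set \<Rightarrow> ('v \<times> 'l) set" where
  "edge_states E = {(v, y). \<exists>u. (u, y, v) \<in> E}"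

text \<open>The construction of \<open>aut\<close> for an arbitrary edge set and root, so that it
  applies to the core of \<open>H\<close> and to a folded graph alike.\<close>

definition nonbacktracking_automaton ::
    "('v \<times> 'x letter \<times> 'v) set \<Rightarrow> 'v \<Rightarrow> ('v \<times> 'x letter, 'x letter) automaton" where
  "nonbacktracking_automaton E r =
     \<lparr>states = edge_states E,
      transitions = {((v, y), z, (w, z)) | v y z w. (v, y) \<in> edge_states E \<and>
                       (v, z, w) \<in> E \<and> z \<noteq> inv_letter y},
      initial = {(v, y) \<in> edge_states E. v = r},
      final = {(v, y) \<in> edge_states E. v = r}\<rparr>"

lemma transition_iff:
  "((v, y), z, (w, z')) \<in> transitions (nonbacktracking_automaton E r) \<longleftrightarrow>
     z' = z \<and> (v, y) \<in> edge_states E \<and> (v, z, w) \<in> E \<and> z \<noteq> inv_letter y"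
  by (auto simp add: nonbacktracking_automaton_def simp del: split_paired_Ex)

lemma transitions_collapse_iff:
  "(p, z, q) \<in> transitions (collapse B S) \<longleftrightarrow>
     (p, z, q) \<in> transitions B \<and> p \<notin> S \<and> q \<notin> S \<or>
     (\<exists>\<sigma>\<in>S. (\<exists>y. (p, y, \<sigma>) \<in> transitions B) \<and> (\<sigma>, z, q) \<in> transitions B)"
  by (simp add: collapse_def)

locale involutive_graph =
  fixes E :: "('v \<times> 'x letter \<times> 'v) set"
  assumes det: "(u, y, v) \<in> E \<Longrightarrow> (u, y, v') \<in> E \<Longrightarrow> v = v'"
    and inverse: "(u, y, v) \<in> E \<Longrightarrow> (v, inv_letter y, u) \<in> E"
begin

lemma codet: "(u, y, v) \<in> E \<Longrightarrow> (u', y, v) \<in> E \<Longrightarrow> u = u'"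
  using det inverse by blast

text \<open>Determinism leaves only one edge with the inverse label at the terminus of
  \<open>e\<close>, namely \<open>inverse_edge e\<close>, so backtracking can be read off the
  labels.\<close>

lemma successively_iff_reduced_labels:
  "is_path E u es v \<Longrightarrow>
     successively (\<lambda>e e'. e' \<noteq> inverse_edge e) es \<longleftrightarrow> reduced (labels es)"
proof (induction es arbitrary: u)
  case (Cons e es)
  show ?case
  proof (cases es)
    case (Cons e' es')
    obtain x y w where e: "e = (x, y, w)" by (cases e)
    obtain z w' where e': "e' = (w, z, w')" and "e \<in> E" "e' \<in> E"
      using Cons.prems Cons e by (cases e') auto
    then have "w' = x" if "z = inv_letter y"
      using det[of w z w' x] inverse[of x y w] e that by simp
    then have "z = inv_letter y \<longleftrightarrow> e' = inverse_edge e"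
      using e e' by auto
    then show ?thesis
      using Cons.IH[of w] Cons.prems Cons e e' by auto
  qed simp
qed simp

lemma is_path_inverse:
  "is_path E u es v \<Longrightarrow> is_path E v (rev (map inverse_edge es)) u"
  by (induction es arbitrary: u) (auto simp: is_path_append intro: inverse)

lemma labels_inverse:
  "labels (rev (map inverse_edge es)) = rev (map inv_letter (labels es))"
  by (induction es) (auto simp: inverse_edge_def)

lemma path_determined:
  "is_path E u es v \<Longrightarrow> is_path E u es' v' \<Longrightarrow> labels es = labels es' \<Longrightarrow> es = es'"
proof (induction es arbitrary: u es')
  case (Cons e es)
  obtain e' es'' where es': "es' = e' # es''"
    using Cons.prems(3) by (cases es') auto
  have "e = e'"
    using Cons.prems es' det by (cases e, cases e') auto
  then show ?case
    using Cons es' by auto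
qed (metis labels_simps(1,4))

end

text \<open>
  \<open>\<theta>\<close> contracts the edges in \<open>C\<close> and nothing else; \<open>r\<close> is the root, which is a vertex even if it
  has no edges.
\<close>

locale edge_folding = involutive_graph E
  for E :: "('v \<times> 'x letter \<times> 'v) set" +
  fixes C :: "('v \<times> 'x letter \<times> 'v) set" and \<theta> :: "'v \<Rightarrow> 'w" and r :: 'v
  assumes C_subset: "C \<subseteq> E"
    and C_inverse: "(u, y, v) \<in> C \<Longrightarrow> (v, inv_letter y, u) \<in> C"
    and C_isolated: "(u, y, v) \<in> C \<Longrightarrow> (v, z, w) \<in> C \<Longrightarrow> z = inv_letter y"
    and C_separates: "(u, y, v) \<in> E - C \<Longrightarrow> (u', y, v') \<in> E - C \<Longrightarrow> (u, b, u') \<notin> C"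
    and \<theta>_C: "(u, y, v) \<in> C \<Longrightarrow> \<theta> u = \<theta> v"
    and \<theta>_eq: "u \<in> insert r (fst ` E) \<Longrightarrow> v \<in> insert r (fst ` E) \<Longrightarrow> \<theta> u = \<theta> v \<Longrightarrow>
      u = v \<or> (\<exists>y. (u, y, v) \<in> C)"
begin

section \<open>Folding reduced paths\<close>

definition image_edges :: "('w \<times> 'x letter \<times> 'w) set" where
  "image_edges = (\<lambda>(u, y, v). (\<theta> u, y, \<theta> v)) ` (E - C)"

definition fold_path :: "('v \<times> 'x letter \<times> 'v) list \<Rightarrow> ('w \<times> 'x letter \<times> 'w) list" where
  "fold_path es = map (\<lambda>(u, y, v). (\<theta> u, y, \<theta> v)) (filter (\<lambda>e. e \<notin> C) es)"

text \<open>A collapsed loop could be followed by itself, and isolation would make its label its own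
  inverse.\<close>

lemma C_no_loop: "(u, y, u) \<notin> C"
  using C_isolated[of u y u y u] by auto

lemma noncollapsed_inverse: "(u, y, v) \<in> E - C \<Longrightarrow> (v, inv_letter y, u) \<in> E - C"
  using inverse C_inverse by fastforce

lemma origin_in: "(u, y, v) \<in> E \<Longrightarrow> u \<in> insert r (fst ` E)"
  and terminus_in: "(u, y, v) \<in> E \<Longrightarrow> v \<in> insert r (fst ` E)"
  by (auto simp: rev_image_eqI dest: inverse)

lemma terminus_\<theta>_eq:
  "(u, y, v) \<in> E \<Longrightarrow> x \<in> insert r (fst ` E) \<Longrightarrow> \<theta> v = \<theta> x \<Longrightarrow> v = x \<or> (\<exists>b. (v, b, x) \<in> C)"
  using \<theta>_eq[of v x] terminus_in by simp

lemma is_path_fold_path: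
  "is_path E u es v \<Longrightarrow> is_path image_edges (\<theta> u) (fold_path es) (\<theta> v)"
proof (induction es arbitrary: u)
  case (Cons e es)
  obtain y w where e: "e = (u, y, w)" "e \<in> E" "is_path E w es v"
    using Cons.prems by (cases e) auto
  show ?case
    using e Cons.IH[of w] \<theta>_C[of u y w]
    by (cases "e \<in> C") (auto simp: fold_path_def image_edges_def rev_image_eqI)
qed (simp add: fold_path_def)

text \<open>Otherwise the inverse of the first edge and the last edge would be non-collapsed edges
  with the same label at the two ends of a collapsed edge, against
  \<open>C_separates\<close>.\<close>

lemma no_backtrack_across:
  assumes "(u, y, v) \<in> E - C" "(v, b, v') \<in> C" "(v', z, w) \<in> E - C"
  shows "z \<noteq> inv_letter y"
  using C_separates noncollapsed_inverse assms by blast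

text \<open>Isolation keeps the collapsed edges of a reduced path apart. So a removal brings
  together two non-collapsed edges with a single collapsed edge between them, and these do not
  cancel by \<open>no_backtrack_across\<close>.\<close>

lemma reduced_fold_path:
  "is_path E u es v \<Longrightarrow> reduced (labels es) \<Longrightarrow> reduced (labels (fold_path es))"
proof (induction es arbitrary: u rule: length_induct)
  case (1 es)
  show ?case
  proof (cases es)
    case Nil
    then show ?thesis by (simp add: fold_path_def)
  next
    case es: (Cons e es')
    obtain y w where e: "e = (u, y, w)" "e \<in> E" "is_path E w es' v"
      using 1 es by (cases e) auto
    have IH: "reduced (labels (fold_path es'))"
      using 1 es e reduced_tl[of y "labels es'"] by auto
    show ?thesis
    proof (cases "e \<in> C \<or> es' = []")
      case True
      then show ?thesis
        using IH es by (auto simp: fold_path_def)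
    next
      case False
      then obtain e' es'' where es': "es' = e' # es''"
        by (cases es') auto
      obtain z x where e': "e' = (w, z, x)" "e' \<in> E" "is_path E x es'' v"
        using e es' by (cases e') auto
      have z: "z \<noteq> inv_letter y"
        using 1 es es' e e' by simp
      show ?thesis
      proof (cases "e' \<in> C")
        case False
        then show ?thesis
          using IH \<open>\<not> (e \<in> C \<or> es' = [])\<close> es es' e e' z by (auto simp: fold_path_def)
      next
        case e'C: True
        show ?thesis
        proof (cases es'')
          case Nil
          then show ?thesis
            using e'C es es' by (auto simp: fold_path_def)
        next
          case (Cons e'' es3)
          obtain z' x' where e'': "e'' = (x, z', x')" "e'' \<in> E"
            using e' Cons by (cases e'') auto
          have "z' \<noteq> inv_letter z"
            using 1 es es' e' e'' Cons by simp
          then have nC: "e'' \<notin> C"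
            using C_isolated e' e'' e'C by blast
          then have "z' \<noteq> inv_letter y"
            using no_backtrack_across e e' e'' e'C \<open>\<not> (e \<in> C \<or> es' = [])\<close> by blast
          then show ?thesis
            using IH nC e'C \<open>\<not> (e \<in> C \<or> es' = [])\<close> es es' e e' e'' Cons
            by (auto simp: fold_path_def)
        qed
      qed
    qed
  qed
qed

section \<open>States and transitions after collapsing\<close>

lemma edge_states_C_iff: "(u, y, v) \<in> E \<Longrightarrow> (v, y) \<in> edge_states C \<longleftrightarrow> (u, y, v) \<in> C"
  using C_subset codet unfolding edge_states_def by blast

text \<open>Two consecutive collapsed edges would be inverse to each other, which a transition
  forbids. Hence collapsed states are never adjacent, and the predecessors of a collapsed state
  survive.\<close>

lemma transition_into_collapsed:
  assumes "((v, y), z, (w, z')) \<in> transitions (nonbacktracking_automaton E r)"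
    and "(w, z') \<in> edge_states C"
  shows "z' = z" "(v, z, w) \<in> C" "z \<noteq> inv_letter y" "(v, y) \<in> edge_states E - edge_states C"
proof -
  have *: "z' = z" "(v, y) \<in> edge_states E" "(v, z, w) \<in> E" "z \<noteq> inv_letter y"
    using assms(1) by (simp_all add: transition_iff)
  then show "z' = z" "z \<noteq> inv_letter y"
    by simp_all
  show C: "(v, z, w) \<in> C"
    using assms(2) * edge_states_C_iff by blast
  show "(v, y) \<in> edge_states E - edge_states C"
    using C * C_isolated unfolding edge_states_def by blast
qed

lemma transition_from_collapsed:
  assumes "((v, y), z, (w, z')) \<in> transitions (nonbacktracking_automaton E r)"
    and "(v, y) \<in> edge_states C"
  shows "z' = z" "(v, z, w) \<in> E - C" "z \<noteq> inv_letter y" "(w, z') \<in> edge_states E - edge_states C"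
proof -
  have *: "z' = z" "(v, z, w) \<in> E" "z \<noteq> inv_letter y"
    using assms(1) by (simp_all add: transition_iff)
  then show "z' = z" "z \<noteq> inv_letter y"
    by simp_all
  show nC: "(v, z, w) \<in> E - C"
    using * assms(2) C_isolated unfolding edge_states_def by blast
  then have "(w, z) \<in> edge_states E"
    unfolding edge_states_def by blast
  then show "(w, z') \<in> edge_states E - edge_states C"
    using nC * edge_states_C_iff by blast
qed

text \<open>Since collapsed states are never adjacent, a transition of the collapsed automaton skips
  at most one collapsed edge.\<close>

lemma collapse_transition_iff:
  "((v, y), z, (w, z')) \<in> transitions (collapse (nonbacktracking_automaton E r) (edge_states C)) \<longleftrightarrow>
     z' = z \<and> (v, y) \<in> edge_states E - edge_states C \<and>
     ((v, z, w) \<in> E - C \<and> z \<noteq> inv_letter y \<or>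
      (\<exists>b v'. (v, b, v') \<in> C \<and> b \<noteq> inv_letter y \<and> (v', z, w) \<in> E - C))"
    (is "?L \<longleftrightarrow> ?R")
proof
  assume ?L
  then consider
      (direct) "((v, y), z, (w, z')) \<in> transitions (nonbacktracking_automaton E r)"
        "(v, y) \<notin> edge_states C" "(w, z') \<notin> edge_states C"
    | (via) v' b b' where "(v', b') \<in> edge_states C"
        "((v, y), b, (v', b')) \<in> transitions (nonbacktracking_automaton E r)"
        "((v', b'), z, (w, z')) \<in> transitions (nonbacktracking_automaton E r)"
    unfolding transitions_collapse_iff by fastforce
  then show ?R
  proof cases
    case direct
    then show ?thesis
      using edge_states_C_iff[of v z w] by (simp add: transition_iff)
  next
    case via
    then show ?thesis
      using transition_into_collapsed[OF via(2,1)] transition_from_collapsed[OF via(3,1)] by blast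
  qed
next
  assume R: ?R
  then consider (direct) "(v, z, w) \<in> E - C" "z \<noteq> inv_letter y"
    | (via) b v' where "(v, b, v') \<in> C" "b \<noteq> inv_letter y" "(v', z, w) \<in> E - C"
    by blast
  then show ?L
  proof cases
    case direct
    then show ?thesis
      using R edge_states_C_iff[of v z w] by (simp add: transitions_collapse_iff transition_iff)
  next
    case via
    have C: "(v', b) \<in> edge_states C" "(v', b) \<in> edge_states E"
      using via C_subset unfolding edge_states_def by blast+
    \<comment> \<open>The inverse of the collapsed edge is collapsed and is the only edge at
      \<open>v'\<close> labeled \<open>inv_letter b\<close>, whereas the edge labeled
      \<open>z\<close> is not collapsed.\<close>
    have "z \<noteq> inv_letter b"
      using via C_inverse det C_subset by blast
    then have "((v', b), z, (w, z)) \<in> transitions (nonbacktracking_automaton E r)"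
      "((v, y), b, (v', b)) \<in> transitions (nonbacktracking_automaton E r)"
      using R via C C_subset by (auto simp: transition_iff)
    then show ?thesis
      using R C(1) unfolding transitions_collapse_iff by blast
  qed
qed

text \<open>Distinct vertices of the graph with the same image are the ends of a collapsed edge. Two
  surviving states with the same label over them would give, by inversion, non-collapsed edges with
  equal labels at both ends, against \<open>C_separates\<close>.\<close>

lemma fold_state_inj:
  "inj_on (\<lambda>(v, y). (\<theta> v, y)) (edge_states E - edge_states C)"
proof (rule inj_onI)
  fix p q
  assume "p \<in> edge_states E - edge_states C" "q \<in> edge_states E - edge_states C"
    and "(case p of (v, y) \<Rightarrow> (\<theta> v, y)) = (case q of (v, y) \<Rightarrow> (\<theta> v, y))"
  then obtain u v u' v' y where pq: "p = (v, y)" "q = (v', y)" and eq: "\<theta> v = \<theta> v'"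
    and *: "(u, y, v) \<in> E - C" "(u', y, v') \<in> E - C"
    unfolding edge_states_def by fastforce
  then have "v = v' \<or> (\<exists>b. (v, b, v') \<in> C)"
    using terminus_\<theta>_eq[of u y v v'] terminus_in[of u' y v'] eq by simp
  then show "p = q"
    using noncollapsed_inverse C_separates * pq by blast
qed

lemma image_edge_states:
  "(\<lambda>(v, y). (\<theta> v, y)) ` (edge_states E - edge_states C) = edge_states image_edges"
proof
  show "(\<lambda>(v, y). (\<theta> v, y)) ` (edge_states E - edge_states C) \<subseteq> edge_states image_edges"
    unfolding edge_states_def image_edges_def by (force simp del: split_paired_Ex)
  show "edge_states image_edges \<subseteq> (\<lambda>(v, y). (\<theta> v, y)) ` (edge_states E - edge_states C)"
  proof
    fix q assume "q \<in> edge_states image_edges"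
    then obtain u y v where q: "q = (\<theta> v, y)" "(u, y, v) \<in> E - C"
      unfolding edge_states_def image_edges_def by auto
    then have "(v, y) \<in> edge_states E - edge_states C"
      using edge_states_C_iff[of u y v] unfolding edge_states_def by blast
    then show "q \<in> (\<lambda>(v, y). (\<theta> v, y)) ` (edge_states E - edge_states C)"
      using q by force
  qed
qed

text \<open>A skipped collapsed edge is invisible after \<theta>. Conversely, a state and an
  outgoing edge of the folded graph lift separately, to a vertex \<open>v\<close> and an origin
  \<open>x\<close> with the same image; if these differ, the collapsed edge from \<open>v\<close> to
  \<open>x\<close> supplies the detour.\<close>

lemma image_transitions:
  "(\<lambda>(p, z, q). (case p of (v, y) \<Rightarrow> (\<theta> v, y), z, case q of (v, y) \<Rightarrow> (\<theta> v, y))) `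
     transitions (collapse (nonbacktracking_automaton E r) (edge_states C)) =
   transitions (nonbacktracking_automaton image_edges (\<theta> r))" (is "?f ` ?T = ?T'")
proof
  show "?f ` ?T \<subseteq> ?T'"
  proof
    fix t assume "t \<in> ?f ` ?T"
    then obtain v y z w z' where t: "((v, y), z, (w, z')) \<in> ?T" "t = ((\<theta> v, y), z, (\<theta> w, z'))"
      by auto
    then have "z' = z" and Q: "(v, y) \<in> edge_states E - edge_states C"
      and *: "(v, z, w) \<in> E - C \<and> z \<noteq> inv_letter y \<or>
        (\<exists>b v'. (v, b, v') \<in> C \<and> b \<noteq> inv_letter y \<and> (v', z, w) \<in> E - C)"
      unfolding collapse_transition_iff by blast+
    have 1: "(\<theta> v, y) \<in> edge_states image_edges"
      using Q image_edge_states by force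
    obtain u where u: "(u, y, v) \<in> E - C"
      using Q unfolding edge_states_def by blast
    from * have 2: "(\<theta> v, z, \<theta> w) \<in> image_edges \<and> z \<noteq> inv_letter y"
    proof (elim disjE exE conjE)
      fix b v' assume v': "(v, b, v') \<in> C" "(v', z, w) \<in> E - C"
      then show ?thesis
        using no_backtrack_across[OF u v'] \<theta>_C[OF v'(1)] unfolding image_edges_def by force
    qed (force simp: image_edges_def)
    show "t \<in> ?T'"
      using 1 2 t \<open>z' = z\<close> by (simp add: transition_iff)
  qed
  show "?T' \<subseteq> ?f ` ?T"
  proof
    fix t assume "t \<in> ?T'"
    then obtain v' y z w' where t: "t = ((v', y), z, (w', z))"
      and v': "(v', y) \<in> edge_states image_edges" "(v', z, w') \<in> image_edges" "z \<noteq> inv_letter y"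
      unfolding nonbacktracking_automaton_def by auto
    obtain v where v: "v' = \<theta> v" "(v, y) \<in> edge_states E - edge_states C"
      using v'(1) unfolding image_edge_states[symmetric] by auto
    obtain x w where x: "v' = \<theta> x" "w' = \<theta> w" "(x, z, w) \<in> E - C"
      using v'(2) unfolding image_edges_def by auto
    obtain u where u: "(u, y, v) \<in> E - C"
      using v unfolding edge_states_def by blast
    have "v = x \<or> (\<exists>b. (v, b, x) \<in> C)"
      using terminus_\<theta>_eq[of u y v x] origin_in[of x z w] v x u by simp
    \<comment> \<open>The edge leaving \<open>v\<close> with the label inverse to \<open>y\<close>
      is the inverse of the edge into \<open>v\<close>, hence not collapsed.\<close>
    moreover have "b \<noteq> inv_letter y" if "(v, b, x) \<in> C" for b
      using that u noncollapsed_inverse det C_subset by blast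
    ultimately have "((v, y), z, (w, z)) \<in> ?T"
      using v x v'(3) unfolding collapse_transition_iff by blast
    then show "t \<in> ?f ` ?T"
      using t v x by force
  qed
qed

text \<open>The vertices over the image of the root are \<open>r\<close> and the other end of a
  collapsed edge at \<open>r\<close>. The predecessors of a collapsed initial state are the
  surviving states at that other end.\<close>

lemma initial_collapse_iff:
  "(v, y) \<in> (initial (nonbacktracking_automaton E r) - edge_states C) \<union>
      {p. \<exists>\<sigma>\<in>initial (nonbacktracking_automaton E r) \<inter> edge_states C.
        \<exists>b. (p, b, \<sigma>) \<in> transitions (nonbacktracking_automaton E r)} \<longleftrightarrow>
    (v, y) \<in> edge_states E - edge_states C \<and> \<theta> v = \<theta> r" (is "?L \<longleftrightarrow> ?R")
proof
  assume ?L
  then consider (direct) "(v, y) \<in> edge_states E - edge_states C" "v = r"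
    | (via) b b' where "((v, y), b, (r, b')) \<in> transitions (nonbacktracking_automaton E r)"
      "(r, b') \<in> edge_states C"
    by (auto simp: nonbacktracking_automaton_def)
  then show ?R
  proof cases
    case via
    then show ?thesis
      using transition_into_collapsed[OF via] \<theta>_C by blast
  qed simp
next
  assume R: ?R
  then obtain u where u: "(u, y, v) \<in> E - C"
    unfolding edge_states_def by blast
  then consider "v = r" | (via) b where "(v, b, r) \<in> C"
    using terminus_\<theta>_eq[of u y v r] R by auto
  then show ?L
  proof cases
    case via
    then have C: "(r, b) \<in> edge_states C" "(r, b) \<in> edge_states E" "(v, b, r) \<in> E"
      using C_subset unfolding edge_states_def by blast+
    have "b \<noteq> inv_letter y"
      using via u noncollapsed_inverse det C_subset by blast
    then have "((v, y), b, (r, b)) \<in> transitions (nonbacktracking_automaton E r)"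
      using R C by (simp add: transition_iff)
    moreover have "(r, b) \<in> initial (nonbacktracking_automaton E r)"
      using C by (simp add: nonbacktracking_automaton_def)
    ultimately show ?thesis
      using C(1) by blast
  qed (use R in \<open>simp add: nonbacktracking_automaton_def\<close>)
qed

lemma image_initial:
  "(\<lambda>(v, y). (\<theta> v, y)) ` ((initial (nonbacktracking_automaton E r) - edge_states C) \<union>
      {p. \<exists>\<sigma>\<in>initial (nonbacktracking_automaton E r) \<inter> edge_states C.
        \<exists>b. (p, b, \<sigma>) \<in> transitions (nonbacktracking_automaton E r)}) =
    {(v, y) \<in> edge_states image_edges. v = \<theta> r}" (is "?f ` ?I = ?I'")
proof -
  have "?I = {p \<in> edge_states E - edge_states C. \<theta> (fst p) = \<theta> r}"
  proof (rule Set.set_eqI)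
    fix p :: "'v \<times> 'x letter"
    obtain v y where p: "p = (v, y)"
      by (cases p)
    show "p \<in> ?I \<longleftrightarrow> p \<in> {p \<in> edge_states E - edge_states C. \<theta> (fst p) = \<theta> r}"
      unfolding p initial_collapse_iff by simp
  qed
  moreover have "?f ` {p \<in> edge_states E - edge_states C. \<theta> (fst p) = \<theta> r} = ?I'"
    unfolding image_edge_states[symmetric] by force
  ultimately show ?thesis
    by simp
qed

theorem collapse_iso:
  "automaton_iso (collapse (nonbacktracking_automaton E r) (edge_states C))
     (nonbacktracking_automaton image_edges (\<theta> r))"
  unfolding automaton_iso_def
proof (intro exI conjI)
  let ?f = "\<lambda>(v, y). (\<theta> v, y)"
  show "bij_betw ?f (states (collapse (nonbacktracking_automaton E r) (edge_states C)))
      (states (nonbacktracking_automaton image_edges (\<theta> r)))"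
    using fold_state_inj image_edge_states
    by (simp add: bij_betw_def collapse_def nonbacktracking_automaton_def)
  show "(\<lambda>(p, z, q). (?f p, z, ?f q)) `
      transitions (collapse (nonbacktracking_automaton E r) (edge_states C)) =
      transitions (nonbacktracking_automaton image_edges (\<theta> r))"
    by (rule image_transitions)
  have "final (nonbacktracking_automaton E r) = initial (nonbacktracking_automaton E r)"
    by (simp add: nonbacktracking_automaton_def)
  with image_initial
  show "?f ` initial (collapse (nonbacktracking_automaton E r) (edge_states C)) =
      initial (nonbacktracking_automaton image_edges (\<theta> r))"
    and "?f ` final (collapse (nonbacktracking_automaton E r) (edge_states C)) =
      final (nonbacktracking_automaton image_edges (\<theta> r))"
    by (simp_all add: collapse_def nonbacktracking_automaton_def)
qed

end

section \<open>Elimination of states from adjacency matrices\<close>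

text \<open>Entries are kept as a function of states rather than of indices, so deleting an index
  only shortens the list and every remaining entry stays attached to its states.\<close>

definition indexed_mat :: "('s \<Rightarrow> 's \<Rightarrow> nat) \<Rightarrow> 's list \<Rightarrow> nat mat" where
  "indexed_mat f ps = mat (length ps) (length ps) (\<lambda>(i, j). f (ps ! i) (ps ! j))"

definition eliminate_state :: "'s \<Rightarrow> ('s \<Rightarrow> 's \<Rightarrow> nat) \<Rightarrow> 's \<Rightarrow> 's \<Rightarrow> nat" where
  "eliminate_state \<sigma> f = (\<lambda>p q. if f p \<sigma> \<noteq> 0 then f p q + f \<sigma> q else f p q)"

lemma eliminate_index_indexed_mat:
  assumes "distinct ps" "\<sigma> \<in> set ps"
  shows "eliminate_index (length (takeWhile (\<lambda>p. p \<noteq> \<sigma>) ps)) (indexed_mat f ps) =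
    indexed_mat (eliminate_state \<sigma> f) (remove1 \<sigma> ps)"
proof -
  obtain us vs where ps: "ps = us @ \<sigma> # vs" "\<sigma> \<notin> set us"
    using assms(2) by (meson split_list_first)
  have k: "length (takeWhile (\<lambda>p. p \<noteq> \<sigma>) ps) = length us"
    unfolding ps(1) using ps(2) by (subst takeWhile_append2) auto
  have rem: "remove1 \<sigma> ps = us @ vs"
    using ps by (simp add: remove1_append)
  \<comment> \<open>\<open>insert_index\<close> skips the position of the deleted state, which
    translates indices of the shortened list into indices of \<open>ps\<close>.\<close>
  have nth: "(us @ vs) ! i = ps ! insert_index (length us) i" for i
    using ps by (auto simp: nth_append insert_index_def Suc_diff_le)
  show ?thesis
    unfolding k rem eliminate_index_def indexed_mat_def
  proof (rule eq_matI, goal_cases)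
    case (1 i j)
    then have "insert_index (length us) i < length ps" "insert_index (length us) j < length ps"
      using ps by (auto simp: insert_index_def)
    moreover have "length us < length ps" "ps ! length us = \<sigma>"
      "i < length ps - 1" "j < length ps - 1"
      using 1 ps by auto
    ultimately show ?case
      using 1 by (simp add: mat_delete_def eliminate_state_def nth insert_index_def)
  qed (use ps in auto)
qed

text \<open>As no entry joins two eliminated states, eliminating one leaves the rows and columns of
  the others unchanged. Their contributions therefore add up, in whatever order they are
  eliminated.\<close>

lemma eliminate_indexed_mat:
  assumes "distinct ps" "distinct ts" "set ts \<subseteq> set ps"
    and "\<And>\<sigma> \<tau>. \<sigma> \<in> set ts \<Longrightarrow> \<tau> \<in> set ts \<Longrightarrow> f \<sigma> \<tau> = 0"
    and "\<And>p \<sigma>. \<sigma> \<in> set ts \<Longrightarrow> f p \<sigma> \<le> 1"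
  shows "eliminate ts ps (indexed_mat f ps) =
    indexed_mat (\<lambda>p q. f p q + (\<Sum>\<sigma>\<in>set ts. f p \<sigma> * f \<sigma> q)) (filter (\<lambda>p. p \<notin> set ts) ps)"
  using assms
proof (induction ts arbitrary: ps f)
  case (Cons \<sigma> ts)
  define g where "g = eliminate_state \<sigma> f"
  have g: "g p q = f p q + f p \<sigma> * f \<sigma> q" for p q
  proof -
    \<comment> \<open>With column entries at most 1, adding the row conditionally is adding it
      multiplied by the column entry.\<close>
    have "f p \<sigma> = 0 \<or> f p \<sigma> = 1"
      using Cons.prems(5)[of \<sigma> p] by auto
    then show ?thesis by (auto simp: g_def eliminate_state_def)
  qed
  have gf: "g p \<tau> = f p \<tau>" "g \<tau> p = f \<tau> p" if "\<tau> \<in> set ts" for p \<tau>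
    using Cons.prems(4) that by (simp_all add: g)
  have *: "filter (\<lambda>p. p \<notin> set ts) (remove1 \<sigma> ps) = filter (\<lambda>p. p \<notin> set (\<sigma> # ts)) ps"
    using Cons.prems(1) by (auto simp: distinct_remove1_removeAll removeAll_filter_not_eq intro: filter_cong)
  have "eliminate (\<sigma> # ts) ps (indexed_mat f ps) =
      eliminate ts (remove1 \<sigma> ps) (indexed_mat g (remove1 \<sigma> ps))"
    using Cons.prems by (simp add: eliminate_index_indexed_mat g_def)
  also have "\<dots> = indexed_mat (\<lambda>p q. g p q + (\<Sum>\<tau>\<in>set ts. g p \<tau> * g \<tau> q))
      (filter (\<lambda>p. p \<notin> set ts) (remove1 \<sigma> ps))"
    using Cons.prems by (intro Cons.IH) (auto simp: gf set_remove1_eq)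
  also have "\<dots> = indexed_mat (\<lambda>p q. f p q + (\<Sum>\<tau>\<in>set (\<sigma> # ts). f p \<tau> * f \<tau> q))
      (filter (\<lambda>p. p \<notin> set (\<sigma> # ts)) ps)"
    using Cons.prems unfolding * by (simp add: gf g add.assoc)
  finally show ?case .
qed simp

definition edge_count :: "('s, 'l) automaton \<Rightarrow> 's \<Rightarrow> 's \<Rightarrow> nat" where
  "edge_count B p q = card {e \<in> transitions B. fst e = p \<and> snd (snd e) = q}"

lemma adjacency_matrix_eq: "adjacency_matrix B ps = indexed_mat (edge_count B) ps"
  by (simp add: adjacency_matrix_def indexed_mat_def edge_count_def)

text \<open>In the automata here the label is a component of the target state, so parallel
  transitions cannot occur and all entries are 0 or 1.\<close>

lemma edge_count_label_determined:
  assumes "\<And>z. (p, z, q) \<in> transitions B \<Longrightarrow> z = snd q"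
  shows "edge_count B p q = of_bool ((p, snd q, q) \<in> transitions B)"
proof -
  have "e = (p, snd q, q)" if "e \<in> transitions B" "fst e = p" "snd (snd e) = q" for e
    using that assms[of "fst (snd e)"] by (cases e) simp
  then have "{e \<in> transitions B. fst e = p \<and> snd (snd e) = q} =
      {e. e = (p, snd q, q) \<and> e \<in> transitions B}"
    by (intro Collect_cong) (metis fst_conv snd_conv)
  then show ?thesis
    by (simp add: edge_count_def Collect_conv_if)
qed

section \<open>Elimination agrees with collapsing\<close>

context edge_folding
begin

lemma edge_count_aut:
  "edge_count (nonbacktracking_automaton E r) p q =
     of_bool ((p, snd q, q) \<in> transitions (nonbacktracking_automaton E r))"
  by (rule edge_count_label_determined) (cases p, cases q, simp add: transition_iff)

lemma edge_count_collapse: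
  "edge_count (collapse (nonbacktracking_automaton E r) (edge_states C)) p q =
     of_bool ((p, snd q, q) \<in> transitions (collapse (nonbacktracking_automaton E r) (edge_states C)))"
  by (rule edge_count_label_determined) (cases p, cases q, simp add: collapse_transition_iff)

text \<open>A direct transition besides the route through \<sigma> would give two edges with the
  same label and terminus, hence equal origins and a collapsed loop. A second route would give two
  collapsed edges leaving one vertex, which isolation and determinism make equal.\<close>

lemma collapsed_route_unique:
  assumes "p \<notin> edge_states C"
    and \<sigma>: "\<sigma> \<in> edge_states C" "(p, snd \<sigma>, \<sigma>) \<in> transitions (nonbacktracking_automaton E r)"
      "(\<sigma>, snd q, q) \<in> transitions (nonbacktracking_automaton E r)"
  shows "(p, snd q, q) \<notin> transitions (nonbacktracking_automaton E r)"
    and "\<tau> \<in> edge_states C \<Longrightarrow> (p, snd \<tau>, \<tau>) \<in> transitions (nonbacktracking_automaton E r) \<Longrightarrow> \<tau> = \<sigma>"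
proof -
  obtain v y v' b w z where pq: "p = (v, y)" "\<sigma> = (v', b)" "q = (w, z)"
    by (cases p, cases \<sigma>, cases q)
  have C: "(v, b, v') \<in> C" and z: "(v', z, w) \<in> E"
    using transition_into_collapsed[of v y b v' b] transition_from_collapsed[of v' b z w z] \<sigma> pq
    by auto
  show "(p, snd q, q) \<notin> transitions (nonbacktracking_automaton E r)"
  proof
    assume "(p, snd q, q) \<in> transitions (nonbacktracking_automaton E r)"
    then have "(v, z, w) \<in> E"
      using pq by (simp add: transition_iff)
    then show False
      using z C codet C_no_loop by blast
  qed
  assume \<tau>: "\<tau> \<in> edge_states C" "(p, snd \<tau>, \<tau>) \<in> transitions (nonbacktracking_automaton E r)"
  obtain v'' b' where \<tau>_eq: "\<tau> = (v'', b')"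
    by (cases \<tau>)
  then have "(v, b', v'') \<in> C"
    using transition_into_collapsed(2)[of v y b' v'' b'] \<tau> pq by simp
  moreover from this have "b' = b"
    using C_isolated[OF C_inverse[OF C]] by simp
  ultimately show "\<tau> = \<sigma>"
    using \<tau>_eq C pq det C_subset by blast
qed

text \<open>\<open>transitions\<close> is a set, so several routes from \<open>p\<close> to
  \<open>q\<close> would count once on the left but repeatedly on the right;
  \<open>collapsed_route_unique\<close> excludes this.\<close>

lemma edge_count_collapse_sum:
  assumes "finite (edge_states C)" "p \<in> edge_states E - edge_states C" "q \<notin> edge_states C"
  defines "B \<equiv> nonbacktracking_automaton E r"
  shows "edge_count (collapse B (edge_states C)) p q =
    edge_count B p q + (\<Sum>\<sigma>\<in>edge_states C. edge_count B p \<sigma> * edge_count B \<sigma> q)"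
proof -
  let ?R = "\<lambda>\<sigma>. (p, snd \<sigma>, \<sigma>) \<in> transitions B \<and> (\<sigma>, snd q, q) \<in> transitions B"
  \<comment> \<open>All factors are 0 or 1, so the sum counts the collapsed states through which a
    route passes.\<close>
  have sum: "(\<Sum>\<sigma>\<in>edge_states C. edge_count B p \<sigma> * edge_count B \<sigma> q) =
      card {\<sigma> \<in> edge_states C. ?R \<sigma>}"
    using assms(1) by (simp add: B_def edge_count_aut of_bool_conj[symmetric] sum_of_bool_eq Collect_conj_eq Int_assoc)
  have label: "z = snd \<sigma>" if "(p, z, \<sigma>) \<in> transitions B" for z \<sigma>
    using that by (cases p, cases \<sigma>) (simp add: B_def transition_iff)
  have iff: "(p, snd q, q) \<in> transitions (collapse B (edge_states C)) \<longleftrightarrow>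
      (p, snd q, q) \<in> transitions B \<or> (\<exists>\<sigma>\<in>edge_states C. ?R \<sigma>)"
    using assms label unfolding transitions_collapse_iff by blast
  show ?thesis
  proof (cases "\<exists>\<sigma>\<in>edge_states C. ?R \<sigma>")
    case True
    then obtain \<sigma> where \<sigma>: "\<sigma> \<in> edge_states C" "?R \<sigma>"
      by blast
    have "p \<notin> edge_states C"
      using assms(2) by blast
    note unique = collapsed_route_unique[OF this, of \<sigma> q, folded B_def]
    have "{\<sigma> \<in> edge_states C. ?R \<sigma>} = {\<sigma>}"
      using unique(2) \<sigma> by blast
    moreover have "(p, snd q, q) \<notin> transitions B"
      using unique(1) \<sigma> by blast
    ultimately show ?thesis
      unfolding sum using \<sigma> iff
      by (auto simp: B_def edge_count_aut edge_count_collapse)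
  next
    case False
    then have "{\<sigma> \<in> edge_states C. ?R \<sigma>} = {}"
      by blast
    then show ?thesis
      unfolding sum using False iff
      by (simp add: B_def edge_count_aut edge_count_collapse del: Collect_empty_eq)
  qed
qed

theorem eliminate_collapse:
  assumes "finite (edge_states C)" and "distinct qs" "set qs = edge_states E - edge_states C"
    and "distinct ss" "set ss = edge_states C" and "distinct ts" "set ts = edge_states C"
  shows "eliminate ts (qs @ ss) (adjacency_matrix (nonbacktracking_automaton E r) (qs @ ss)) =
    adjacency_matrix (collapse (nonbacktracking_automaton E r) (edge_states C)) qs"
proof -
  let ?B = "nonbacktracking_automaton E r"
  \<comment> \<open>This supplies the vanishing entries between eliminated states that
    \<open>eliminate_indexed_mat\<close> asks for.\<close>
  have "(\<sigma>, z, \<tau>) \<notin> transitions ?B" if "\<sigma> \<in> edge_states C" "\<tau> \<in> edge_states C" for \<sigma> z \<tau>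
    using that transition_into_collapsed(4) by (cases \<sigma>, cases \<tau>) blast
  then have "eliminate ts (qs @ ss) (indexed_mat (edge_count ?B) (qs @ ss)) =
      indexed_mat (\<lambda>p q. edge_count ?B p q + (\<Sum>\<sigma>\<in>set ts. edge_count ?B p \<sigma> * edge_count ?B \<sigma> q))
        (filter (\<lambda>p. p \<notin> set ts) (qs @ ss))"
    using assms by (intro eliminate_indexed_mat) (auto simp: edge_count_aut)
  moreover have "filter (\<lambda>p. p \<notin> set ts) (qs @ ss) = qs"
    using assms by (simp add: filter_id_conv)
  moreover have "qs ! i \<in> edge_states E - edge_states C" if "i < length qs" for i
    using assms(3) that nth_mem by blast
  ultimately show ?thesis
    unfolding adjacency_matrix_eq using assms
    by (auto simp: indexed_mat_def edge_count_collapse_sum intro!: cong_mat)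
qed

end

section \<open>Schreier graphs and cores\<close>

definition schreier_graph :: "'x word set \<Rightarrow> ('x coset \<times> 'x letter \<times> 'x coset) set" where
  "schreier_graph K = sym_edges (schreier_edges K)"

lemma r_coset_mult:
  "K \<subseteq> carrier \<F> \<Longrightarrow> reduced g \<Longrightarrow> reduced h \<Longrightarrow>
     (K #>\<^bsub>\<F>\<^esub> g) #>\<^bsub>\<F>\<^esub> h = K #>\<^bsub>\<F>\<^esub> (g \<otimes>\<^bsub>\<F>\<^esub> h)"
  by (rule FG.coset_mult_assoc) auto

lemma r_coset_Nil: "K \<subseteq> carrier \<F> \<Longrightarrow> K #>\<^bsub>\<F>\<^esub> [] = K"
  using FG.coset_mult_one[of K] by (simp add: one_free_group)

lemma r_coset_inv_letter:
  "V \<subseteq> carrier \<F> \<Longrightarrow> (V #>\<^bsub>\<F>\<^esub> [y]) #>\<^bsub>\<F>\<^esub> [inv_letter y] = V"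
  "V \<subseteq> carrier \<F> \<Longrightarrow> (V #>\<^bsub>\<F>\<^esub> [inv_letter y]) #>\<^bsub>\<F>\<^esub> [y] = V"
  by (simp_all add: r_coset_mult r_coset_Nil)

lemma rcosets_iff:
  "V \<in> rcosets\<^bsub>\<F>\<^esub> K \<longleftrightarrow> (\<exists>g. reduced g \<and> V = K #>\<^bsub>\<F>\<^esub> g)"
  by (auto simp: RCOSETS_def)

lemma rcosets_subset:
  assumes "V \<in> rcosets\<^bsub>\<F>\<^esub> K" "K \<subseteq> carrier \<F>"
  shows "V \<subseteq> carrier \<F>"
proof -
  obtain g where "reduced g" "V = K #>\<^bsub>\<F>\<^esub> g"
    using assms(1) unfolding rcosets_iff by blast
  then show ?thesis
    using FG.r_coset_subset_G[OF assms(2), of g] by simp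
qed

lemma rcosets_r_coset:
  assumes "K \<subseteq> carrier \<F>" "V \<in> rcosets\<^bsub>\<F>\<^esub> K" "reduced h"
  shows "V #>\<^bsub>\<F>\<^esub> h \<in> rcosets\<^bsub>\<F>\<^esub> K"
proof -
  obtain g where g: "reduced g" "V = K #>\<^bsub>\<F>\<^esub> g"
    using assms(2) unfolding rcosets_iff by blast
  then have "V #>\<^bsub>\<F>\<^esub> h = K #>\<^bsub>\<F>\<^esub> (g \<otimes>\<^bsub>\<F>\<^esub> h)"
    using assms by (simp add: r_coset_mult)
  moreover have "reduced (g \<otimes>\<^bsub>\<F>\<^esub> h)"
    by (simp add: mult_free_group)
  ultimately show ?thesis
    unfolding rcosets_iff by blast
qed

text \<open>An edge labeled by an inverse letter is a reversed generator edge, and right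
  multiplications by a letter and by its inverse undo each other; thus both signs obey one
  rule.\<close>

lemma schreier_graph_iff:
  assumes "K \<subseteq> carrier \<F>"
  shows "(u, y, v) \<in> schreier_graph K \<longleftrightarrow> u \<in> rcosets\<^bsub>\<F>\<^esub> K \<and> v = u #>\<^bsub>\<F>\<^esub> [y]"
proof (cases y)
  case (Pair x b)
  show ?thesis
  proof (cases b)
    case True
    then show ?thesis
      using Pair by (auto simp: schreier_graph_def sym_edges_def schreier_edges_def)
  next
    case False
    then have y: "inv_letter y = (x, True)" "y = (x, False)"
      using Pair by (simp_all add: inv_letter_def)
    have "(u, y, v) \<in> schreier_graph K \<longleftrightarrow> v \<in> rcosets\<^bsub>\<F>\<^esub> K \<and> u = v #>\<^bsub>\<F>\<^esub> [inv_letter y]"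
      unfolding y(1) using y(2) by (auto simp: schreier_graph_def sym_edges_def schreier_edges_def)
    then show ?thesis
      using assms r_coset_inv_letter rcosets_subset rcosets_r_coset by (metis reduced_singleton)
  qed
qed

lemma involutive_schreier_graph:
  assumes "K \<subseteq> carrier \<F>"
  shows "involutive_graph (schreier_graph K)"
proof
  show "v = v'" if "(u, y, v) \<in> schreier_graph K" "(u, y, v') \<in> schreier_graph K" for u y v v'
    using that assms by (simp add: schreier_graph_iff)
  show "(v, inv_letter y, u) \<in> schreier_graph K" if "(u, y, v) \<in> schreier_graph K" for u y v
  proof -
    have v: "u \<in> rcosets\<^bsub>\<F>\<^esub> K" "v = u #>\<^bsub>\<F>\<^esub> [y]"
      using that assms by (simp_all add: schreier_graph_iff)
    then have "v \<in> rcosets\<^bsub>\<F>\<^esub> K" "u = v #>\<^bsub>\<F>\<^esub> [inv_letter y]"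
      using rcosets_r_coset[OF assms v(1), of "[y]"] r_coset_inv_letter(1)[OF rcosets_subset[OF v(1) assms]]
      by simp_all
    then show ?thesis
      using assms by (simp add: schreier_graph_iff)
  qed
qed

lemma schreier_path_terminus:
  assumes "K \<subseteq> carrier \<F>"
  shows "u \<in> rcosets\<^bsub>\<F>\<^esub> K \<Longrightarrow> is_path (schreier_graph K) u es v \<Longrightarrow>
    v = u #>\<^bsub>\<F>\<^esub> reduce (labels es)"
proof (induction es arbitrary: u)
  case Nil
  then show ?case
    using assms rcosets_subset[of u K] by (simp add: r_coset_Nil)
next
  case (Cons e es)
  obtain y where e: "e = (u, y, u #>\<^bsub>\<F>\<^esub> [y])"
    and path: "is_path (schreier_graph K) (u #>\<^bsub>\<F>\<^esub> [y]) es v"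
    using Cons.prems assms by (cases e) (auto simp: schreier_graph_iff)
  have "u #>\<^bsub>\<F>\<^esub> [y] \<in> rcosets\<^bsub>\<F>\<^esub> K"
    by (intro rcosets_r_coset assms Cons.prems(1)) simp
  then have "v = (u #>\<^bsub>\<F>\<^esub> [y]) #>\<^bsub>\<F>\<^esub> reduce (labels es)"
    using path by (rule Cons.IH)
  then show ?case
    using e rcosets_subset[OF Cons.prems(1) assms] by (simp add: r_coset_mult reduce_Cons_mult)
qed

lemma schreier_path_exists:
  assumes "K \<subseteq> carrier \<F>"
  shows "u \<in> rcosets\<^bsub>\<F>\<^esub> K \<Longrightarrow> \<exists>es v. is_path (schreier_graph K) u es v \<and> labels es = w"
proof (induction w arbitrary: u)
  case Nil
  show ?case
    by (intro exI[of _ "[]"] exI[of _ u]) simp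
next
  case (Cons y w)
  have "u #>\<^bsub>\<F>\<^esub> [y] \<in> rcosets\<^bsub>\<F>\<^esub> K"
    by (intro rcosets_r_coset assms Cons.prems) simp
  then obtain es v where "is_path (schreier_graph K) (u #>\<^bsub>\<F>\<^esub> [y]) es v" "labels es = w"
    using Cons.IH by blast
  then have "is_path (schreier_graph K) u ((u, y, u #>\<^bsub>\<F>\<^esub> [y]) # es) v \<and>
      labels ((u, y, u #>\<^bsub>\<F>\<^esub> [y]) # es) = y # w"
    using assms Cons.prems by (simp add: schreier_graph_iff)
  then show ?case by blast
qed

section \<open>Reduced loops and the core\<close>

definition ext_edges :: "'x word set \<Rightarrow> ('x coset \<times> 'x letter \<times> 'x coset) set" where
  "ext_edges K = edges (extended_core K)"

text \<open>Backtracking is tested on the labels, so that loops can be compared with reduced words;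
  by determinism these are still the reduced closed paths at the root.\<close>

definition core_loop :: "'x word set \<Rightarrow> ('x coset \<times> 'x letter \<times> 'x coset) list \<Rightarrow> bool" where
  "core_loop K es \<longleftrightarrow> is_path (schreier_graph K) K es K \<and> reduced (labels es)"

lemma inverse_in_schreier_graph:
  assumes "subgroup K \<F>"
  shows "inverse_edge e \<in> schreier_graph K \<longleftrightarrow> e \<in> schreier_graph K"
proof -
  have "inverse_edge e \<in> schreier_graph K" if "e \<in> schreier_graph K" for e
    using that involutive_graph.inverse[OF involutive_schreier_graph[OF subgroup.subset[OF assms]]]
    by (cases e) (simp only: inverse_edge_simp)
  from this[of e] this[of "inverse_edge e"] show ?thesis
    by auto
qed

lemma core_loop_edge:
  assumes "subgroup K \<F>" "core_loop K es" "e \<in> set es \<or> inverse_edge e \<in> set es"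
  shows "e \<in> schreier_graph K"
proof -
  have "e \<in> schreier_graph K \<or> inverse_edge e \<in> schreier_graph K"
    using assms is_path_subset[of "schreier_graph K" K es K] by (auto simp: core_loop_def)
  then show ?thesis
    by (simp add: inverse_in_schreier_graph[OF assms(1)])
qed

lemma sym_edges_True: "(u, (x, True), v) \<in> sym_edges E \<longleftrightarrow> (u, x, v) \<in> E"
  and sym_edges_False: "(u, (x, False), v) \<in> sym_edges E \<longleftrightarrow> (v, x, u) \<in> E"
  by (auto simp: sym_edges_def)

text \<open>The extended core is symmetric, so a loop may use an edge in either direction and the
  sign of its letter needs no separate treatment afterwards.\<close>

lemma ext_edges_iff:
  assumes "subgroup K \<F>"
  shows "e \<in> ext_edges K \<longleftrightarrow> (\<exists>es. core_loop K es \<and> (e \<in> set es \<or> inverse_edge e \<in> set es))"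
proof -
  interpret involutive_graph "schreier_graph K"
    by (simp add: assms involutive_schreier_graph subgroup.subset)
  have loop: "reduced_closed_path (schreier_edges K) K es \<longleftrightarrow> core_loop K es" for es
    unfolding reduced_closed_path_def core_loop_def schreier_graph_def[symmetric]
    using successively_iff_reduced_labels by blast
  obtain u x b v where e: "e = (u, (x, b), v)"
    by (cases e) auto
  have "e \<in> ext_edges K \<longleftrightarrow> e \<in> schreier_graph K \<and>
      (\<exists>es. core_loop K es \<and> (e \<in> set es \<or> inverse_edge e \<in> set es))"
    unfolding e ext_edges_def extended_core_def core_def
    by (cases b) (auto simp: sym_edges_True sym_edges_False core_edges_def loop schreier_graph_def inv_letter_def)
  then show ?thesis
    using core_loop_edge[OF assms] by blast
qed

lemma ext_edges_subset:
  assumes "subgroup K \<F>"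
  shows "ext_edges K \<subseteq> schreier_graph K"
proof
  fix e assume "e \<in> ext_edges K"
  then show "e \<in> schreier_graph K"
    unfolding ext_edges_iff[OF assms] using core_loop_edge[OF assms] by blast
qed

lemma involutive_ext_edges:
  assumes "subgroup K \<F>"
  shows "involutive_graph (ext_edges K)"
proof
  interpret involutive_graph "schreier_graph K"
    by (simp add: assms involutive_schreier_graph subgroup.subset)
  show "v = v'" if "(u, y, v) \<in> ext_edges K" "(u, y, v') \<in> ext_edges K" for u y v v'
    using that ext_edges_subset[OF assms] det by blast
  show "(v, inv_letter y, u) \<in> ext_edges K" if "(u, y, v) \<in> ext_edges K" for u y v
    using that unfolding ext_edges_iff[OF assms] by auto
qed

lemma core_loop_ext_path:
  assumes "subgroup K \<F>" "core_loop K es"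
  shows "is_path (ext_edges K) K es K"
proof -
  have "set es \<subseteq> ext_edges K"
    using assms(2) ext_edges_iff[OF assms(1)] by blast
  then show ?thesis
    using assms(2) is_path_mono[of "schreier_graph K" K es K] by (simp add: core_loop_def)
qed

lemma origin_sym_edges_iff:
  "u \<in> fst ` sym_edges E \<longleftrightarrow> (\<exists>x v. (u, x, v) \<in> E \<or> (v, x, u) \<in> E)" (is "?L \<longleftrightarrow> ?R")
proof
  assume ?L
  then show ?R
    unfolding sym_edges_def by fastforce
next
  assume ?R
  then obtain x b v where "(u, (x, b), v) \<in> sym_edges E"
    using sym_edges_True sym_edges_False by metis
  then show ?L
    by (rule rev_image_eqI) simp
qed

lemma verts_core:
  assumes "subgroup K \<F>"
  shows "verts (core K) = insert K (fst ` ext_edges K)"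
proof -
  have "u \<in> (\<Union>(u, x, v)\<in>core_edges K. {u, v}) \<longleftrightarrow> u \<in> fst ` sym_edges (core_edges K)" for u
    unfolding origin_sym_edges_iff UN_iff case_prod_unfold Bex_def split_paired_Ex fst_conv snd_conv
    by (metis insert_iff singletonD)
  then show ?thesis
    unfolding core_def ext_edges_def extended_core_def by auto
qed

text \<open>An edge of the core lies on a reduced loop at the root in one of its two directions, and
  an initial segment of that loop ends at \<open>u\<close>.\<close>

lemma ext_path_to_origin:
  assumes K: "subgroup K \<F>" and "u \<in> insert K (fst ` ext_edges K)"
  obtains es where "is_path (ext_edges K) K es u" "reduced (labels es)"
proof (cases "u = K")
  case True
  then show ?thesis
    using that[of "[]"] by simp
next
  case False
  then obtain e where e: "fst e = u" "e \<in> ext_edges K"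
    using assms by auto
  then obtain es where es: "core_loop K es" "e \<in> set es \<or> inverse_edge e \<in> set es"
    unfolding ext_edges_iff[OF K] by blast
  have path: "is_path (ext_edges K) K es K" "reduced (labels es)"
    using core_loop_ext_path[OF K] es by (auto simp: core_loop_def)
  from es(2) show ?thesis
  proof
    assume "e \<in> set es"
    then obtain p q where "es = p @ e # q"
      by (meson split_list)
    then show ?thesis
      using path e that[of p] by (auto simp: is_path_append reduced_append_iff)
  next
    \<comment> \<open>Traversed backwards, the edge ends at \<open>u\<close>, so the segment has to
      include it.\<close>
    assume "inverse_edge e \<in> set es"
    then obtain p q where "es = (p @ [inverse_edge e]) @ q"
      by (metis append.assoc append_Cons append_Nil split_list)
    moreover have "snd (snd (inverse_edge e)) = u"
      using e by (cases e) auto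
    ultimately show ?thesis
      using path that[of "p @ [inverse_edge e]"] unfolding is_path_append labels_simps(3) reduced_append_iff
      by (auto simp: is_path_append reduced_append_iff)
  qed
qed

text \<open>
  Join the two ends of the edge to the root by reduced paths in the core. Either the edge extends
  them to a reduced closed path, or it already is an edge of one of them.
\<close>

lemma ext_edges_induced:
  assumes K: "subgroup K \<F>"
    and "u \<in> insert K (fst ` ext_edges K)" "v \<in> insert K (fst ` ext_edges K)"
    and "(u, y, v) \<in> schreier_graph K"
  shows "(u, y, v) \<in> ext_edges K"
proof -
  interpret S: involutive_graph "schreier_graph K"
    by (simp add: K involutive_schreier_graph subgroup.subset)
  interpret X: involutive_graph "ext_edges K"
    by (rule involutive_ext_edges[OF K])
  obtain es where es: "is_path (ext_edges K) K es u" "reduced (labels es)"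
    by (rule ext_path_to_origin[OF K assms(2)])
  obtain es' where es': "is_path (ext_edges K) K es' v" "reduced (labels es')"
    by (rule ext_path_to_origin[OF K assms(3)])
  define fs where "fs = rev (map inverse_edge es')"
  have fs: "is_path (ext_edges K) v fs K" "reduced (labels fs)"
    using es' X.is_path_inverse unfolding fs_def X.labels_inverse reduced_inverse by blast+
  have mono: "is_path (schreier_graph K) x ds x'" if "is_path (ext_edges K) x ds x'" for x ds x'
    using is_path_mono[OF that] is_path_subset[OF that] ext_edges_subset[OF K] by blast
  consider (last) "es \<noteq> []" "last (labels es) = inv_letter y"
    | (first) "fs \<noteq> []" "hd (labels fs) = inv_letter y"
    | (reduced) "es \<noteq> [] \<longrightarrow> last (labels es) \<noteq> inv_letter y" "fs \<noteq> [] \<longrightarrow> hd (labels fs) \<noteq> inv_letter y"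
    by blast
  then show ?thesis
  proof cases
    case last
    then obtain ds e where "es = ds @ [e]"
      by (meson rev_exhaust)
    then have "(fst e, inv_letter y, u) \<in> ext_edges K"
      using es last by (cases e) (simp add: is_path_append)
    then have "(u, y, fst e) \<in> ext_edges K"
      using X.inverse[of "fst e" "inv_letter y" u] by simp
    then show ?thesis
      using assms(4) ext_edges_subset[OF K] S.det by blast
  next
    case first
    then obtain e ds where "fs = e # ds"
      by (meson list.exhaust)
    then have e: "(v, inv_letter y, snd (snd e)) \<in> ext_edges K"
      using fs first by (cases e) simp
    then have "snd (snd e) = u"
      using S.inverse[OF assms(4)] ext_edges_subset[OF K] S.det by blast
    then show ?thesis
      using e X.inverse[of v "inv_letter y" u] by simp
  next
    case reduced
    have "core_loop K (es @ (u, y, v) # fs)"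
      unfolding core_loop_def
    proof
      show "is_path (schreier_graph K) K (es @ (u, y, v) # fs) K"
        using es fs mono assms(4) by (auto simp: is_path_append)
      have "reduced (y # labels fs)"
        using reduced fs by (cases fs) auto
      then show "reduced (labels (es @ (u, y, v) # fs))"
        using reduced(1) es by (simp add: reduced_append_iff) (metis inv_letter_inv_letter)
    qed
    then show ?thesis
      unfolding ext_edges_iff[OF K] by auto
  qed
qed

lemma aut_eq: "subgroup K \<F> \<Longrightarrow> aut K = nonbacktracking_automaton (ext_edges K) K"
proof -
  assume K: "subgroup K \<F>"
  interpret X: involutive_graph "ext_edges K"
    by (rule involutive_ext_edges[OF K])
  have "v \<in> verts (extended_core K)" if "(u, y, v) \<in> ext_edges K" for u y v
    using X.inverse[OF that] verts_core[OF K] by (force simp: extended_core_def)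
  then have "aut_states K = edge_states (ext_edges K)"
    unfolding aut_states_def edge_states_def ext_edges_def by blast
  then show ?thesis
    unfolding aut_def nonbacktracking_automaton_def by (simp add: ext_edges_def)
qed

section \<open>The core of the image under a Whitehead automorphism\<close>

lemma reduced_mult [simp]: "reduced (u \<otimes>\<^bsub>\<F>\<^esub> v)"
  by (simp add: mult_free_group)

lemma reduced_inv [simp]: "reduced w \<Longrightarrow> reduced (inv\<^bsub>\<F>\<^esub> w)"
  using FG.inv_closed by simp

lemma mult_inv_cancel:
  "reduced u \<Longrightarrow> reduced v \<Longrightarrow> u \<otimes>\<^bsub>\<F>\<^esub> (inv\<^bsub>\<F>\<^esub> u \<otimes>\<^bsub>\<F>\<^esub> v) = v"
  "reduced u \<Longrightarrow> reduced v \<Longrightarrow> inv\<^bsub>\<F>\<^esub> u \<otimes>\<^bsub>\<F>\<^esub> (u \<otimes>\<^bsub>\<F>\<^esub> v) = v"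
  by (simp_all add: FG.m_assoc[symmetric] one_free_group)

lemma labels_at_iff: "z \<in> labels_at K v \<longleftrightarrow> (\<exists>w. (v, z, w) \<in> ext_edges K)"
  by (simp add: labels_at_def ext_edges_def)

locale whitehead_collapse =
  fixes H :: "'x word set" and A :: "'x letter set" and a :: "'x letter"
    and \<phi> :: "'x word \<Rightarrow> 'x word"
  assumes H: "subgroup H \<F>"
    and whitehead: "whitehead_automorphism A a \<phi>"
    and kinds: "v \<in> verts (core H) \<Longrightarrow>
        (vertex_kind1 H A v \<and> \<not> vertex_kind2 H A v \<and> \<not> vertex_kind3 H A a v) \<or>
        (\<not> vertex_kind1 H A v \<and> vertex_kind2 H A v \<and> \<not> vertex_kind3 H A a v) \<or>
        (\<not> vertex_kind1 H A v \<and> \<not> vertex_kind2 H A v \<and> vertex_kind3 H A a v)"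
begin

text \<open>
  \<open>d v\<close> is the displacement of the vertex \<open>v\<close>, and \<open>\<delta> y\<close> that of an origin of a half-edge labeled
  \<open>y\<close>; they agree off \<open>C\<close>. The subgroup \<open>K\<close> is the conjugate of \<open>\<phi> ` H\<close> by the displacement of the
  root.
\<close>

definition \<delta> :: "'x letter \<Rightarrow> 'x word" where
  "\<delta> y = (if y \<in> A then [a] else [])"

definition d :: "'x coset \<Rightarrow> 'x word" where
  "d v = (if vertex_kind1 H A v then [] else [a])"

definition C :: "('x coset \<times> 'x letter \<times> 'x coset) set" where
  "C = {(u, y, v) \<in> ext_edges H.
     y = a \<and> vertex_kind3 H A a u \<or> y = inv_letter a \<and> vertex_kind3 H A a v}"

definition h :: "'x word \<Rightarrow> 'x word" where
  "h g = inv\<^bsub>\<F>\<^esub> (d H) \<otimes>\<^bsub>\<F>\<^esub> \<phi> g"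

text \<open>The vertex is first moved by its displacement, and \<open>h\<close> then carries cosets
  of \<open>H\<close> to cosets of \<open>K\<close>. So the coset of \<open>g\<close> goes to the
  coset of \<phi> \<open>g\<close> multiplied by \<open>d v\<close> on the right and by the inverse
  of \<open>d H\<close> on the left.\<close>

definition \<theta> :: "'x coset \<Rightarrow> 'x coset" where
  "\<theta> v = h ` (v #>\<^bsub>\<F>\<^esub> d v)"

definition K :: "'x word set" where
  "K = (\<lambda>g. inv\<^bsub>\<F>\<^esub> (d H) \<otimes>\<^bsub>\<F>\<^esub> \<phi> g \<otimes>\<^bsub>\<F>\<^esub> d H) ` H"

lemma C_iff: "(u, y, v) \<in> C \<longleftrightarrow> (u, y, v) \<in> ext_edges H \<and>
    (y = a \<and> vertex_kind3 H A a u \<or> y = inv_letter a \<and> vertex_kind3 H A a v)"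
  by (simp add: C_def)

lemma reduced_\<delta> [simp]: "reduced (\<delta> y)" and reduced_d [simp]: "reduced (d v)"
  by (simp_all add: \<delta>_def d_def)

lemma H_subset: "H \<subseteq> carrier \<F>"
  by (rule subgroup.subset[OF H])

lemma a_notin: "a \<notin> A" "inv_letter a \<notin> A"
  using whitehead by (simp_all add: whitehead_automorphism_def)

lemma phi_iso: "\<phi> \<in> iso \<F> \<F>"
  using whitehead by (simp add: whitehead_automorphism_def)

sublocale phi: group_hom \<F> \<F> \<phi>
  using phi_iso group_free_group
  by (intro group_hom.intro group_hom_axioms.intro) (auto simp: iso_def)

lemma reduced_phi [simp]: "reduced g \<Longrightarrow> reduced (\<phi> g)"
  using phi.hom_closed by simp

lemma phi_a: "\<phi> [a] = [a]"
  using whitehead by (simp add: whitehead_automorphism_def)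

lemma phi_Nil: "\<phi> [] = []"
  using phi.hom_one by (simp add: one_free_group)

lemma phi_inv_a: "\<phi> [inv_letter a] = [inv_letter a]"
  using phi.hom_inv[of "[a]"] by (simp add: phi_a inv_singleton)

lemma phi_d [simp]: "\<phi> (d v) = d v"
  by (simp add: d_def phi_a phi_Nil)

text \<open>An edge is shifted by \<delta> of its letter at the origin and, read backwards, by
  \<delta> of the inverse letter at the terminus. For \<open>a\<close> and its inverse both
  corrections vanish; for an inverse generator they change places when the formula for the generator
  is inverted.\<close>

lemma phi_letter: "\<phi> [y] = \<delta> y \<otimes>\<^bsub>\<F>\<^esub> [y] \<otimes>\<^bsub>\<F>\<^esub> inv\<^bsub>\<F>\<^esub> \<delta> (inv_letter y)"
proof (cases "fst y = fst a")
  case True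
  then have "y = a \<or> y = inv_letter a"
    by (auto simp: inv_letter_def prod_eq_iff)
  moreover have "inv\<^bsub>\<F>\<^esub> [] = ([] :: 'x word)"
    using FG.inv_one by (simp add: one_free_group)
  ultimately show ?thesis
    using a_notin by (auto simp: \<delta>_def phi_a phi_inv_a)
next
  case False
  have pos: "\<phi> [y] = \<delta> y \<otimes>\<^bsub>\<F>\<^esub> [y] \<otimes>\<^bsub>\<F>\<^esub> inv\<^bsub>\<F>\<^esub> \<delta> (inv_letter y)"
    if y: "fst y \<noteq> fst a" "snd y" for y
  proof -
    have "y = (fst y, True)" "inv_letter y = (fst y, False)"
      using y by (simp_all add: inv_letter_def prod_eq_iff)
    then have "\<phi> [y] = (if y \<in> A then [a] else []) @ [y] @
        (if inv_letter y \<in> A then [inv_letter a] else [])"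
      using whitehead y(1) unfolding whitehead_automorphism_def by metis
    moreover have "inv\<^bsub>\<F>\<^esub> [] = ([] :: 'x word)"
      using FG.inv_one by (simp add: one_free_group)
    moreover have "y \<noteq> a" "y \<noteq> inv_letter a" "inv_letter a \<noteq> inv_letter y"
      using y by (auto simp: inv_letter_def)
    ultimately show ?thesis
      by (auto simp: \<delta>_def inv_singleton mult_free_group reduce_Cons)
  qed
  show ?thesis
  proof (cases "snd y")
    case False
    let ?t = "inv_letter y"
    have "fst ?t \<noteq> fst a" "snd ?t"
      using False \<open>fst y \<noteq> fst a\<close> by (simp_all add: inv_letter_def)
    then have "\<phi> [?t] = \<delta> ?t \<otimes>\<^bsub>\<F>\<^esub> [?t] \<otimes>\<^bsub>\<F>\<^esub> inv\<^bsub>\<F>\<^esub> \<delta> y"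
      using pos[of ?t] by simp
    moreover have "\<phi> [y] = inv\<^bsub>\<F>\<^esub> \<phi> [?t]"
      using phi.hom_inv[of "[?t]"] by (simp add: inv_singleton)
    moreover have "inv\<^bsub>\<F>\<^esub> [?t] = [y]"
      by (simp add: inv_singleton)
    ultimately show ?thesis
      by (simp add: FG.inv_mult_group FG.m_assoc)
  qed (use pos False in blast)
qed

section \<open>Displacements and collapsed edges\<close>

lemma verts_H: "verts (core H) = insert H (fst ` ext_edges H)"
  by (rule verts_core[OF H])

sublocale X: involutive_graph "ext_edges H"
  by (rule involutive_ext_edges[OF H])

lemma edge_verts:
  "(u, y, v) \<in> ext_edges H \<Longrightarrow> u \<in> verts (core H)" "(u, y, v) \<in> ext_edges H \<Longrightarrow> v \<in> verts (core H)"
  using X.inverse[of u y v] unfolding verts_H by force+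

lemma ext_edge_terminus: "(u, y, v) \<in> ext_edges H \<Longrightarrow> v = u #>\<^bsub>\<F>\<^esub> [y]"
  using ext_edges_subset[OF H] schreier_graph_iff[OF H_subset] by blast

lemma rcoset_of_edge: "(u, y, v) \<in> ext_edges H \<Longrightarrow> u \<in> rcosets\<^bsub>\<F>\<^esub> H"
  using ext_edges_subset[OF H] schreier_graph_iff[OF H_subset] by blast

lemma H_in_rcosets: "H \<in> rcosets\<^bsub>\<F>\<^esub> H"
  unfolding rcosets_iff using r_coset_Nil[OF H_subset] reduced_Nil by metis

lemma rcoset_vert: "u \<in> verts (core H) \<Longrightarrow> u \<in> rcosets\<^bsub>\<F>\<^esub> H"
  unfolding verts_H using rcoset_of_edge H_in_rcosets by auto

lemma vert_subset: "u \<in> verts (core H) \<Longrightarrow> u \<subseteq> carrier \<F>"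
  using rcosets_subset[OF rcoset_vert H_subset] .

text \<open>At the first kind no label lies in \<open>A\<close>, at the second all do, and at the
  third all except \<open>a\<close> do. So all half-edges at a vertex, a collapsed
  \<open>a\<close>-edge excepted, demand the same displacement.\<close>

lemma d_label:
  assumes "v \<in> verts (core H)" "y \<in> labels_at H v" "\<not> (y = a \<and> vertex_kind3 H A a v)"
  shows "d v = \<delta> y"
  using kinds[OF assms(1)] assms(2,3)
  unfolding d_def \<delta>_def vertex_kind1_def vertex_kind2_def vertex_kind3_def by auto

lemma d_noncollapsed:
  assumes "(u, y, v) \<in> ext_edges H - C"
  shows "d u = \<delta> y"
  using assms edge_verts(1)[of u y v] by (intro d_label) (auto simp: labels_at_iff C_iff)

lemma d_kind3: "v \<in> verts (core H) \<Longrightarrow> vertex_kind3 H A a v \<Longrightarrow> d v = [a]"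
  using kinds unfolding d_def by auto

text \<open>The terminus has the inverse of \<open>a\<close> among its labels. This letter lies
  outside \<open>A\<close> and differs from \<open>a\<close>, so \<open>d_label\<close> yields no
  displacement.\<close>

lemma d_inv_a:
  assumes "(u, a, v) \<in> ext_edges H"
  shows "d v = []"
  using d_label[of v "inv_letter a"] edge_verts[OF assms] X.inverse[OF assms] a_notin
  by (auto simp: labels_at_iff \<delta>_def)

text \<open>Exactly one end of a collapsed edge is displaced, and which one it is reveals the label;
  this is why consecutive collapsed edges are inverse to each other.\<close>

lemma d_C:
  assumes "(u, y, v) \<in> C"
  shows "y = a \<and> d u = [a] \<and> d v = [] \<or> y = inv_letter a \<and> d u = [] \<and> d v = [a]"
proof -
  have e: "(u, y, v) \<in> ext_edges H" "(v, inv_letter y, u) \<in> ext_edges H"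
    using assms X.inverse by (simp_all add: C_iff)
  from assms consider "y = a" "vertex_kind3 H A a u" | "y = inv_letter a" "vertex_kind3 H A a v"
    by (auto simp: C_iff)
  then show ?thesis
  proof cases
    case 1
    then show ?thesis
      using e edge_verts d_kind3 d_inv_a by blast
  next
    case 2
    then show ?thesis
      using e edge_verts d_kind3 d_inv_a[of v u] by auto
  qed
qed

lemma C_inverse: "(u, y, v) \<in> C \<Longrightarrow> (v, inv_letter y, u) \<in> C"
  using X.inverse by (auto simp: C_iff)

lemma edge_states_C: "edge_states C = collapsed_states H A a"
proof -
  have "(\<exists>u. (u, y, v) \<in> C) \<longleftrightarrow> y = inv_letter a \<and> v \<in> S_o H A a \<or> y = a \<and> v \<in> S_t H A a" for v y
  proof -
    \<comment> \<open>The third kind requires an outgoing \<open>a\<close>-edge, so every vertex of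
      \<open>S_o\<close> does give a collapsed edge.\<close>
    have "vertex_kind3 H A a u \<longleftrightarrow> vertex_kind3 H A a u \<and> (\<exists>w. (u, a, w) \<in> ext_edges H)" for u
      by (auto simp: vertex_kind3_def labels_at_iff)
    moreover have "(u, a, w) \<in> ext_edges H \<longleftrightarrow> (w, inv_letter a, u) \<in> ext_edges H" for u w
      using X.inverse[of u a w] X.inverse[of w "inv_letter a" u] by auto
    ultimately show ?thesis
      using edge_verts unfolding C_iff S_o_def S_t_def ext_edges_def[symmetric] by blast
  qed
  then show ?thesis
    unfolding edge_states_def collapsed_states_def by auto
qed

section \<open>The folding map on cosets\<close>

lemma image_h_r_coset:
  assumes "V \<subseteq> carrier \<F>" "reduced x"
  shows "h ` (V #>\<^bsub>\<F>\<^esub> x) = h ` V #>\<^bsub>\<F>\<^esub> \<phi> x"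
proof -
  have "h (g \<otimes>\<^bsub>\<F>\<^esub> x) = h g \<otimes>\<^bsub>\<F>\<^esub> \<phi> x" if "g \<in> V" for g
    using that assms phi.hom_mult[of g x] by (auto simp: h_def FG.m_assoc subset_iff)
  then show ?thesis
    by (force simp: r_coset_def)
qed

lemma h_inj: "inj_on h (carrier \<F>)"
proof (rule inj_onI)
  fix x y :: "'x word"
  assume *: "x \<in> carrier \<F>" "y \<in> carrier \<F>" "h x = h y"
  then have "\<phi> x = \<phi> y"
    unfolding h_def by (metis carrier_free_group mult_inv_cancel(1) reduced_d reduced_phi)
  then show "x = y"
    using phi_iso * by (auto simp: iso_def bij_betw_def inj_on_def)
qed

lemma \<theta>_H: "\<theta> H = K"
proof -
  have "\<theta> H = h ` H #>\<^bsub>\<F>\<^esub> d H"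
    unfolding \<theta>_def by (simp add: image_h_r_coset[OF H_subset])
  then show ?thesis
    by (auto simp: K_def r_coset_def h_def)
qed

lemma K_subgroup: "subgroup K \<F>"
proof -
  have "(\<lambda>g. inv\<^bsub>\<F>\<^esub> (d H) \<otimes>\<^bsub>\<F>\<^esub> \<phi> g \<otimes>\<^bsub>\<F>\<^esub> d H) \<in> hom \<F> \<F>"
  proof (rule homI)
    fix x y :: "'x word"
    assume "x \<in> carrier \<F>" "y \<in> carrier \<F>"
    then have "reduced x" "reduced y" "reduced (\<phi> x)" "reduced (\<phi> y)"
      by auto
    then show "inv\<^bsub>\<F>\<^esub> (d H) \<otimes>\<^bsub>\<F>\<^esub> \<phi> (x \<otimes>\<^bsub>\<F>\<^esub> y) \<otimes>\<^bsub>\<F>\<^esub> d H =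
        inv\<^bsub>\<F>\<^esub> (d H) \<otimes>\<^bsub>\<F>\<^esub> \<phi> x \<otimes>\<^bsub>\<F>\<^esub> d H \<otimes>\<^bsub>\<F>\<^esub> (inv\<^bsub>\<F>\<^esub> (d H) \<otimes>\<^bsub>\<F>\<^esub> \<phi> y \<otimes>\<^bsub>\<F>\<^esub> d H)"
      by (simp add: phi.hom_mult FG.m_assoc mult_inv_cancel)
  qed auto
  then interpret psi: group_hom \<F> \<F> "\<lambda>g. inv\<^bsub>\<F>\<^esub> (d H) \<otimes>\<^bsub>\<F>\<^esub> \<phi> g \<otimes>\<^bsub>\<F>\<^esub> d H"
    by (intro group_hom.intro group_hom_axioms.intro group_free_group)
  show ?thesis
    unfolding K_def by (rule psi.subgroup_img_is_subgroup[OF H])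
qed

lemma \<theta>_eq_iff:
  assumes "u \<in> verts (core H)" "v \<in> verts (core H)"
  shows "\<theta> u = \<theta> v \<longleftrightarrow> u #>\<^bsub>\<F>\<^esub> d u = v #>\<^bsub>\<F>\<^esub> d v"
  unfolding \<theta>_def using assms vert_subset
  by (intro inj_on_image_eq_iff[OF h_inj] FG.r_coset_subset_G) auto

sublocale edge_folding "ext_edges H" C \<theta> H
proof
  show "C \<subseteq> ext_edges H"
    by (auto simp: C_iff)
  show "(v, inv_letter y, u) \<in> C" if "(u, y, v) \<in> C" for u y v
    using that by (rule C_inverse)
  show "z = inv_letter y" if "(u, y, v) \<in> C" "(v, z, w) \<in> C" for u y v z w
    using d_C[OF that(1)] d_C[OF that(2)] by auto
  \<comment> \<open>Equal labels force equal displacements at the two origins, whereas the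
    displacements at the ends of a collapsed edge differ.\<close>
  show "(u, b, u') \<notin> C" if "(u, y, v) \<in> ext_edges H - C" "(u', y, v') \<in> ext_edges H - C"
    for u y v u' v' b
    using d_noncollapsed[OF that(1)] d_noncollapsed[OF that(2)] d_C[of u b u'] by auto
  show "\<theta> u = \<theta> v" if "(u, y, v) \<in> C" for u y v
  proof -
    have e: "(u, y, v) \<in> ext_edges H"
      using that by (simp add: C_iff)
    have "u #>\<^bsub>\<F>\<^esub> d u = v #>\<^bsub>\<F>\<^esub> d v"
      using d_C[OF that] ext_edge_terminus[OF e] vert_subset[OF edge_verts(1)[OF e]]
        vert_subset[OF edge_verts(2)[OF e]]
      by (auto simp: r_coset_Nil r_coset_inv_letter)
    then show ?thesis
      by (simp add: \<theta>_def)
  qed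
  \<comment> \<open>The core is an induced subgraph, so it contains the \<open>a\<close>-edge from
    \<open>u\<close> to \<open>v\<close>. Its origin has displacement \<open>[a]\<close> although
    \<open>\<delta> a\<close> is empty, which by \<open>d_label\<close> happens only at the third
    kind.\<close>
  have *: "(u, a, v) \<in> C" if "u \<in> verts (core H)" "v \<in> verts (core H)"
      "d u = [a]" "v = u #>\<^bsub>\<F>\<^esub> [a]" for u v
  proof -
    have "(u, a, v) \<in> schreier_graph H"
      using that rcoset_vert by (simp add: schreier_graph_iff[OF H_subset])
    then have e: "(u, a, v) \<in> ext_edges H"
      using that by (intro ext_edges_induced[OF H]) (simp_all add: verts_H)
    then have "vertex_kind3 H A a u"
      using d_label[of u a] that a_notin by (auto simp: labels_at_iff \<delta>_def)
    then show ?thesis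
      using e by (simp add: C_iff)
  qed
  show "u = v \<or> (\<exists>y. (u, y, v) \<in> C)"
    if "u \<in> insert H (fst ` ext_edges H)" "v \<in> insert H (fst ` ext_edges H)" "\<theta> u = \<theta> v" for u v
  proof -
    have uv: "u \<in> verts (core H)" "v \<in> verts (core H)"
      using that by (simp_all add: verts_H)
    then have eq: "u #>\<^bsub>\<F>\<^esub> d u = v #>\<^bsub>\<F>\<^esub> d v"
      using that \<theta>_eq_iff by simp
    consider "d u = []" "d v = []" | "d u = [a]" "d v = []" | "d u = []" "d v = [a]"
      | "d u = [a]" "d v = [a]"
      unfolding d_def by metis
    then show ?thesis
    proof cases
      case 4
      then have "u #>\<^bsub>\<F>\<^esub> [a] #>\<^bsub>\<F>\<^esub> [inv_letter a] = v #>\<^bsub>\<F>\<^esub> [a] #>\<^bsub>\<F>\<^esub> [inv_letter a]"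
        using eq by simp
      then show ?thesis
        by (simp add: r_coset_inv_letter vert_subset uv)
    next
      case 3
      then have "(v, a, u) \<in> C"
        using *[OF uv(2,1)] eq by (simp add: r_coset_Nil vert_subset uv)
      then show ?thesis
        using C_inverse by blast
    next
      case 2
      then have "(u, a, v) \<in> C"
        using *[OF uv] eq by (simp add: r_coset_Nil vert_subset uv)
      then show ?thesis
        by blast
    qed (use eq in \<open>simp add: r_coset_Nil vert_subset uv\<close>)
  qed
qed

text \<open>Off \<open>C\<close> the two corrections in \<open>phi_letter\<close> are the
  displacements of the ends, the second one by passing to the inverse edge, so the last factor
  cancels against \<open>d v\<close>.\<close>

lemma phi_noncollapsed:
  assumes "(u, y, v) \<in> ext_edges H - C"
  shows "\<phi> [y] \<otimes>\<^bsub>\<F>\<^esub> d v = d u \<otimes>\<^bsub>\<F>\<^esub> [y]"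
proof -
  have "d u = \<delta> y" "d v = \<delta> (inv_letter y)"
    using d_noncollapsed assms noncollapsed_inverse by blast+
  then show ?thesis
    by (simp add: phi_letter FG.m_assoc one_free_group)
qed

lemma phi_collapsed:
  assumes "(u, y, v) \<in> C"
  shows "\<phi> [y] \<otimes>\<^bsub>\<F>\<^esub> d v = d u"
  using d_C[OF assms] by (auto simp: phi_a phi_inv_a)

text \<open>The displacements telescope along the path: a non-collapsed edge passes its letter on,
  and a collapsed edge only converts one displacement into the other.\<close>

lemma phi_path_labels:
  "is_path (ext_edges H) u es v \<Longrightarrow>
     \<phi> (reduce (labels es)) \<otimes>\<^bsub>\<F>\<^esub> d v = d u \<otimes>\<^bsub>\<F>\<^esub> reduce (labels (fold_path es))"
proof (induction es arbitrary: u)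
  case Nil
  then show ?case
    by (simp add: fold_path_def phi_Nil)
next
  case (Cons e es)
  obtain y w where e: "e = (u, y, w)" "e \<in> ext_edges H" "is_path (ext_edges H) w es v"
    using Cons.prems by (cases e) auto
  have "\<phi> (reduce (labels (e # es))) \<otimes>\<^bsub>\<F>\<^esub> d v = \<phi> [y] \<otimes>\<^bsub>\<F>\<^esub> (\<phi> (reduce (labels es)) \<otimes>\<^bsub>\<F>\<^esub> d v)"
    using e by (simp add: reduce_Cons_mult FG.m_assoc)
  also have "\<dots> = \<phi> [y] \<otimes>\<^bsub>\<F>\<^esub> d w \<otimes>\<^bsub>\<F>\<^esub> reduce (labels (fold_path es))"
    using Cons.IH e by (simp add: FG.m_assoc)
  also have "\<dots> = d u \<otimes>\<^bsub>\<F>\<^esub> reduce (labels (fold_path (e # es)))"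
  proof (cases "e \<in> C")
    case True
    then show ?thesis
      using phi_collapsed e by (simp add: fold_path_def)
  next
    case False
    then show ?thesis
      using phi_noncollapsed[of u y w] e by (simp add: fold_path_def reduce_Cons_mult FG.m_assoc)
  qed
  finally show ?case .
qed

section \<open>Reduced loops under folding, and their lifts\<close>

lemma K_subset: "K \<subseteq> carrier \<F>"
  by (rule subgroup.subset[OF K_subgroup])

lemma \<theta>_rcoset:
  assumes "u \<in> verts (core H)"
  shows "\<theta> u \<in> rcosets\<^bsub>\<F>\<^esub> K"
proof -
  obtain g where g: "reduced g" "u = H #>\<^bsub>\<F>\<^esub> g"
    using rcoset_vert[OF assms] unfolding rcosets_iff by blast
  have K: "K = h ` H #>\<^bsub>\<F>\<^esub> d H"
    unfolding \<theta>_H[symmetric] \<theta>_def by (simp add: image_h_r_coset[OF H_subset])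
  have sub: "h ` H \<subseteq> carrier \<F>"
    using H_subset by (auto simp: h_def)
  have "\<theta> u = h ` H #>\<^bsub>\<F>\<^esub> \<phi> (g \<otimes>\<^bsub>\<F>\<^esub> d u)"
    unfolding \<theta>_def g(2) using g(1) H_subset FG.m_closed[of g "d u"]
    by (simp add: r_coset_mult image_h_r_coset)
  also have "\<dots> = K #>\<^bsub>\<F>\<^esub> (inv\<^bsub>\<F>\<^esub> (d H) \<otimes>\<^bsub>\<F>\<^esub> \<phi> (g \<otimes>\<^bsub>\<F>\<^esub> d u))"
    unfolding K using sub g(1) FG.m_closed[of g "d u"] FG.m_closed[of "inv\<^bsub>\<F>\<^esub> (d H)" "\<phi> (g \<otimes>\<^bsub>\<F>\<^esub> d u)"]
    by (simp add: r_coset_mult FG.m_assoc[symmetric])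
  finally show ?thesis
    unfolding rcosets_iff by (meson reduced_mult)
qed

lemma image_edges_subset_schreier: "image_edges \<subseteq> schreier_graph K"
proof
  fix e assume "e \<in> image_edges"
  then obtain u y v where e: "e = (\<theta> u, y, \<theta> v)" "(u, y, v) \<in> ext_edges H - C"
    unfolding image_edges_def by auto
  have u: "u \<in> verts (core H)" "u \<subseteq> carrier \<F>" and v: "v = u #>\<^bsub>\<F>\<^esub> [y]"
    using e edge_verts vert_subset ext_edge_terminus by blast+
  have hu: "h ` u \<subseteq> carrier \<F>"
    using u by (auto simp: h_def)
  have "\<theta> v = h ` u #>\<^bsub>\<F>\<^esub> \<phi> ([y] \<otimes>\<^bsub>\<F>\<^esub> d v)"
    unfolding \<theta>_def using u by (subst v) (simp add: r_coset_mult image_h_r_coset)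
  also have "\<dots> = h ` u #>\<^bsub>\<F>\<^esub> (d u \<otimes>\<^bsub>\<F>\<^esub> [y])"
    using phi_noncollapsed[OF e(2)] by simp
  also have "\<dots> = \<theta> u #>\<^bsub>\<F>\<^esub> [y]"
    unfolding \<theta>_def using u hu by (simp add: image_h_r_coset r_coset_mult)
  finally show "e \<in> schreier_graph K"
    using e \<theta>_rcoset[OF u(1)] by (simp add: schreier_graph_iff[OF K_subset])
qed

lemma core_loop_fold_path:
  assumes "core_loop H es"
  shows "core_loop K (fold_path es)"
proof -
  have path: "is_path (ext_edges H) H es H" "reduced (labels es)"
    using core_loop_ext_path[OF H assms] assms by (simp_all add: core_loop_def)
  have "is_path image_edges K (fold_path es) K"
    using is_path_fold_path[OF path(1)] by (simp add: \<theta>_H)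
  then have "is_path (schreier_graph K) K (fold_path es) K"
    using is_path_mono[of image_edges K "fold_path es" K "schreier_graph K"]
      is_path_subset[of image_edges K "fold_path es" K] image_edges_subset_schreier by simp
  then show ?thesis
    using reduced_fold_path[OF path] by (simp add: core_loop_def)
qed

text \<open>Reading \<open>g\<close> from the root closes up because right multiplication by
  \<open>g\<close> fixes the coset \<open>H\<close>. The folded labels are reduced, so
  \<open>reduce\<close> disappears from \<open>phi_path_labels\<close>.\<close>

lemma core_loop_of_word:
  assumes "g \<in> H"
  obtains es where "core_loop H es" "labels es = g"
    "\<phi> g \<otimes>\<^bsub>\<F>\<^esub> d H = d H \<otimes>\<^bsub>\<F>\<^esub> labels (fold_path es)"
proof -
  have g: "reduced g"
    using assms H_subset by auto
  obtain es v where es: "is_path (schreier_graph H) H es v" "labels es = g"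
    using schreier_path_exists[OF H_subset H_in_rcosets] by blast
  have "v = H"
    using schreier_path_terminus[OF H_subset H_in_rcosets es(1)] es g FG.coset_join2[of g H] assms H
    by simp
  then have loop: "core_loop H es"
    using es g by (simp add: core_loop_def)
  moreover have "\<phi> g \<otimes>\<^bsub>\<F>\<^esub> d H = d H \<otimes>\<^bsub>\<F>\<^esub> labels (fold_path es)"
    using phi_path_labels[OF core_loop_ext_path[OF H loop]] core_loop_fold_path[OF loop] g es
    by (simp add: core_loop_def)
  ultimately show ?thesis
    using that es by blast
qed

text \<open>The labels of the given loop form an element of \<open>K\<close>, hence come from some
  \<open>g\<close> in \<open>H\<close>. The loop reading \<open>g\<close> folds to a path from the
  root with the same labels, which determinism identifies with the given one.\<close>

lemma core_loop_lift:
  assumes "core_loop K es'"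
  obtains es where "core_loop H es" "fold_path es = es'"
proof -
  interpret SK: involutive_graph "schreier_graph K"
    by (rule involutive_schreier_graph[OF K_subset])
  have es': "is_path (schreier_graph K) K es' K" "reduced (labels es')"
    using assms by (simp_all add: core_loop_def)
  have "K \<in> rcosets\<^bsub>\<F>\<^esub> K"
    unfolding rcosets_iff using r_coset_Nil[OF K_subset] reduced_Nil by metis
  then have "K = K #>\<^bsub>\<F>\<^esub> labels es'"
    using schreier_path_terminus[OF K_subset _ es'(1)] es'(2) by simp
  then have "labels es' \<in> K"
    using FG.coset_join1[of K "labels es'"] K_subgroup es'(2) by simp
  then obtain g where g: "g \<in> H" "labels es' = inv\<^bsub>\<F>\<^esub> (d H) \<otimes>\<^bsub>\<F>\<^esub> \<phi> g \<otimes>\<^bsub>\<F>\<^esub> d H"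
    unfolding K_def by blast
  obtain es where es: "core_loop H es"
    "\<phi> g \<otimes>\<^bsub>\<F>\<^esub> d H = d H \<otimes>\<^bsub>\<F>\<^esub> labels (fold_path es)"
    using core_loop_of_word[OF g(1)] by blast
  have fold: "is_path (schreier_graph K) K (fold_path es) K" "reduced (labels (fold_path es))"
    using core_loop_fold_path[OF es(1)] by (simp_all add: core_loop_def)
  have "reduced g"
    using g H_subset by auto
  then have "labels es' = labels (fold_path es)"
    using g(2) es(2) fold(2) by (simp add: FG.m_assoc mult_inv_cancel)
  then have "fold_path es = es'"
    using SK.path_determined[OF fold(1) es'(1)] by simp
  then show ?thesis
    using that es(1) by blast
qed

lemma image_edges_inverse: "inverse_edge e \<in> image_edges \<Longrightarrow> e \<in> image_edges"
proof -
  assume "inverse_edge e \<in> image_edges"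
  then obtain u y v where e: "inverse_edge e = (\<theta> u, y, \<theta> v)" "(u, y, v) \<in> ext_edges H - C"
    unfolding image_edges_def by auto
  then have "e = (\<theta> v, inv_letter y, \<theta> u)"
    by (metis inverse_edge_inverse_edge inverse_edge_simp)
  moreover have "(v, inv_letter y, u) \<in> ext_edges H - C"
    by (rule noncollapsed_inverse[OF e(2)])
  ultimately show ?thesis
    unfolding image_edges_def by (metis (no_types, lifting) case_prod_conv rev_image_eqI)
qed

text \<open>Core edges are those on reduced loops, and folding maps the reduced loops of
  \<open>H\<close> onto those of \<open>K\<close>, keeping precisely the non-collapsed
  edges.\<close>

theorem ext_edges_K: "ext_edges K = image_edges"
proof
  show "ext_edges K \<subseteq> image_edges"
  proof
    fix e assume "e \<in> ext_edges K"
    then obtain es' where es': "core_loop K es'" "e \<in> set es' \<or> inverse_edge e \<in> set es'"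
      unfolding ext_edges_iff[OF K_subgroup] by blast
    obtain es where es: "core_loop H es" "fold_path es = es'"
      by (rule core_loop_lift[OF es'(1)])
    have "set es' \<subseteq> image_edges"
      using is_path_subset[OF is_path_fold_path[OF core_loop_ext_path[OF H es(1)]]] es(2) by simp
    then show "e \<in> image_edges"
      using es'(2) image_edges_inverse by blast
  qed
  show "image_edges \<subseteq> ext_edges K"
  proof
    fix e assume "e \<in> image_edges"
    then obtain u y v where e: "e = (\<theta> u, y, \<theta> v)" "(u, y, v) \<in> ext_edges H - C"
      unfolding image_edges_def by auto
    obtain es where es: "core_loop H es"
      "(u, y, v) \<in> set es \<or> inverse_edge (u, y, v) \<in> set es"
      using e(2) unfolding ext_edges_iff[OF H] Diff_iff by blast
    have image: "(\<theta> u, y, \<theta> v) \<in> set (fold_path es)" if "(u, y, v) \<in> set es" "(u, y, v) \<notin> C" for u y v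
      using that unfolding fold_path_def by force
    have "e \<in> set (fold_path es) \<or> inverse_edge e \<in> set (fold_path es)"
      using es(2) image[of u y v] image[of v "inv_letter y" u] e noncollapsed_inverse[OF e(2)]
      by auto
    then show "e \<in> ext_edges K"
      unfolding ext_edges_iff[OF K_subgroup] using core_loop_fold_path[OF es(1)] by blast
  qed
qed

theorem collapse_iso_aut_K:
  "automaton_iso (collapse (aut H) (collapsed_states H A a)) (aut K)"
  using collapse_iso
  by (simp add: aut_eq[OF H] aut_eq[OF K_subgroup] ext_edges_K \<theta>_H edge_states_C)

section \<open>The root of the image\<close>

lemma K_kind1: "vertex_kind1 H A H \<Longrightarrow> K = \<phi> ` H"
proof -
  assume "vertex_kind1 H A H"
  then have "d H = []" "inv\<^bsub>\<F>\<^esub> [] = ([] :: 'x word)"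
    using FG.inv_one by (simp_all add: d_def one_free_group)
  moreover have "reduced (\<phi> g)" if "g \<in> H" for g
    using that H_subset by auto
  ultimately show ?thesis
    unfolding K_def by (simp cong: image_cong)
qed

lemma K_not_kind1: "\<not> vertex_kind1 H A H \<Longrightarrow> K = conj_by a (\<phi> ` H)"
  by (simp add: K_def d_def conj_by_def image_image)

text \<open>
  If the root is not of the first kind, each nontrivial element of \<open>\<phi> ` H\<close> is \<open>a w a\<inverse>\<close> as a
  reduced word, since it has to traverse the stem.
\<close>

lemma root_no_inverse_a:
  assumes "\<not> vertex_kind1 H A H"
  shows "(K, inv_letter a, v') \<notin> ext_edges K"
proof
  assume "(K, inv_letter a, v') \<in> ext_edges K"
  then obtain u v where u: "\<theta> u = \<theta> H" "(u, inv_letter a, v) \<in> ext_edges H - C"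
    unfolding ext_edges_K image_edges_def \<theta>_H by auto
  have d: "d u = []" "d H = [a]"
    using d_noncollapsed[OF u(2)] a_notin assms by (simp_all add: \<delta>_def d_def)
  have "u = H \<or> (\<exists>b. (u, b, H) \<in> C)"
    using \<theta>_eq[of u H] u origin_in by blast
  then obtain b where b: "(u, b, H) \<in> C"
    using d by auto
  \<comment> \<open>A collapsed edge with undisplaced origin has this label, so determinism
    identifies it with the non-collapsed edge at \<open>u\<close>.\<close>
  then have "b = inv_letter a"
    using d_C d by fastforce
  then show False
    using b u X.det C_subset by blast
qed

lemma cyclically_reduced_image_trivial:
  assumes "\<not> vertex_kind1 H A H" "g \<in> H" "cyclically_reduced (\<phi> g)"
  shows "\<phi> g = []"
proof (rule ccontr)
  assume "\<phi> g \<noteq> []"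
  interpret XK: involutive_graph "ext_edges K"
    by (rule involutive_ext_edges[OF K_subgroup])
  obtain es where es: "core_loop H es" "\<phi> g \<otimes>\<^bsub>\<F>\<^esub> d H = d H \<otimes>\<^bsub>\<F>\<^esub> labels (fold_path es)"
    using core_loop_of_word[OF assms(2)] by blast
  define fs where "fs = fold_path es"
  define w where "w = labels fs"
  have fs: "is_path (ext_edges K) K fs K" "reduced w"
    using core_loop_fold_path[OF es(1)] core_loop_ext_path[OF K_subgroup]
    unfolding fs_def w_def by (simp_all add: core_loop_def)
  have g: "reduced (\<phi> g)"
    using assms(2) H_subset by auto
  have "\<phi> g \<otimes>\<^bsub>\<F>\<^esub> [a] \<otimes>\<^bsub>\<F>\<^esub> [inv_letter a] = [a] \<otimes>\<^bsub>\<F>\<^esub> w \<otimes>\<^bsub>\<F>\<^esub> [inv_letter a]"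
    using es(2) assms(1) by (simp add: w_def fs_def d_def)
  then have eq: "\<phi> g = [a] \<otimes>\<^bsub>\<F>\<^esub> w \<otimes>\<^bsub>\<F>\<^esub> [inv_letter a]"
    using g by (simp add: FG.m_assoc)
  have "w \<noteq> []"
    using eq \<open>\<phi> g \<noteq> []\<close> by auto
  have "hd w \<noteq> inv_letter a"
  proof
    assume "hd w = inv_letter a"
    then have "(K, inv_letter a, snd (snd (hd fs))) \<in> ext_edges K"
      using fs \<open>w \<noteq> []\<close> unfolding w_def by (cases fs) auto
    then show False
      using root_no_inverse_a assms(1) by blast
  qed
  moreover have "last w \<noteq> a"
  proof
    assume "last w = a"
    obtain ds e where ds: "fs = ds @ [e]"
      using \<open>w \<noteq> []\<close> unfolding w_def by (cases fs rule: rev_cases) auto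
    then have "(fst e, a, K) \<in> ext_edges K"
      using fs \<open>last w = a\<close> unfolding w_def by (cases e) (auto simp: is_path_append)
    then show False
      using XK.inverse root_no_inverse_a assms(1) by blast
  qed
  \<comment> \<open>Nothing cancels at either end, so the conjugate is this very word, which begins
    with \<open>a\<close> and ends with its inverse.\<close>
  ultimately have "reduced (a # w @ [inv_letter a])"
    using fs(2) \<open>w \<noteq> []\<close> reduced_append_iff[of "[a]" "w @ [inv_letter a]"]
    by (simp add: reduced_append_iff)
  then have "\<phi> g = a # w @ [inv_letter a]"
    using eq by (simp add: mult_free_group reduce_reduce_append)
  then show False
    using assms(3) by (simp add: cyclically_reduced_def)
qed

text \<open>Otherwise the cyclically reduced generators of the image would all be trivial, and the
  image with them.\<close>

lemma standing_assumption_kind1: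
  assumes "standing_assumption (\<phi> ` H)"
  shows "vertex_kind1 H A H"
proof (rule ccontr)
  assume not1: "\<not> vertex_kind1 H A H"
  obtain Y where Y: "\<And>w. w \<in> Y \<Longrightarrow> cyclically_reduced w" "\<phi> ` H = generate \<F> Y"
    using assms unfolding standing_assumption_def generated_by_cyclically_reduced_def by blast
  have "w = []" if "w \<in> Y" for w
  proof -
    have "w \<in> \<phi> ` H"
      unfolding Y(2) using that by (rule generate.incl)
    then show ?thesis
      using cyclically_reduced_image_trivial[OF not1] Y(1)[OF that] by blast
  qed
  then have "Y \<subseteq> {\<one>\<^bsub>\<F>\<^esub>}"
    by (auto simp: one_free_group)
  then have "\<phi> ` H \<subseteq> {\<one>\<^bsub>\<F>\<^esub>}"
    using FG.mono_generate FG.generate_one unfolding Y(2) by blast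
  moreover have "\<one>\<^bsub>\<F>\<^esub> \<in> \<phi> ` H"
    unfolding Y(2) by (rule generate.one)
  ultimately show False
    using assms unfolding standing_assumption_def by blast
qed

end

section \<open>Finiteness and the conclusion\<close>

lemma finite_edge_states:
  assumes "finite E"
  shows "finite (edge_states E)"
proof (rule finite_surj[OF assms])
  show "edge_states E \<subseteq> (\<lambda>(u, y, v). (v, y)) ` E"
  proof
    fix p assume "p \<in> edge_states E"
    then obtain u where "(u, snd p, fst p) \<in> E"
      unfolding edge_states_def by auto
    then show "p \<in> (\<lambda>(u, y, v). (v, y)) ` E"
      by (rule rev_image_eqI) simp
  qed
qed

lemma finite_sym_edges:
  assumes "finite E"
  shows "finite (sym_edges E)"
proof (rule finite_subset)
  let ?f = "\<lambda>(u, x, v). (u, (x, True), v)" and ?g = "\<lambda>(u, x, v). (v, (x, False), u)"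
  show "sym_edges E \<subseteq> ?f ` E \<union> ?g ` E"
  proof
    fix e assume "e \<in> sym_edges E"
    then obtain u x v where e: "(u, x, v) \<in> E" "e = ?f (u, x, v) \<or> e = ?g (u, x, v)"
      unfolding sym_edges_def by auto
    from e(2) show "e \<in> ?f ` E \<union> ?g ` E"
      using imageI[OF e(1), of ?f] imageI[OF e(1), of ?g] by (elim disjE) (simp_all only: Un_iff simp_thms)
  qed
qed (use assms in simp)

theorem corollary4p2:
  fixes H :: "'x::finite word set"
    and A :: "'x letter set" and a :: "'x letter" and \<phi> :: "'x word \<Rightarrow> 'x word"
    and S Q :: "'x state set" and B :: "('x state, 'x letter) automaton"
  assumes rank: "card (UNIV :: 'x set) > 2"
    and H: "standing_assumption H"
    and factor: "free_factor H"
    and cut: "\<exists>b. cut_vertex H b"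
    and phi: "ascari_automorphism H A a \<phi>"
    and S: "S = collapsed_states H A a"
    and Q: "Q = states (aut H) - S"
    and B: "B = collapse (aut H) S"
  shows "finite (states (aut H)) \<and> S \<subseteq> states (aut H) \<and>
    (\<forall>qs ss ts M M\<^sub>1.
       distinct qs \<and> set qs = Q \<and> distinct ss \<and> set ss = S \<and> distinct ts \<and> set ts = S \<and>
       M = adjacency_matrix (aut H) (qs @ ss) \<and> M\<^sub>1 = eliminate ts (qs @ ss) M \<longrightarrow>
         (\<forall>i < dim_row M. \<forall>k < dim_col M.
            (qs @ ss) ! k \<in> S \<and> M $$ (i, k) \<noteq> 0 \<longrightarrow> M $$ (i, k) = 1) \<and>
         M\<^sub>1 = adjacency_matrix B qs) \<and>
    (standing_assumption (\<phi> ` H) \<longrightarrow> automaton_iso B (aut (\<phi> ` H))) \<and>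
    (if vertex_kind1 H A H then automaton_iso B (aut (\<phi> ` H))
     else automaton_iso B (aut (conj_by a (\<phi> ` H))))"
proof -
  have subgroup_H: "subgroup H \<F>"
    using H by (simp add: standing_assumption_def)
  interpret whitehead_collapse H A a \<phi>
  proof (rule whitehead_collapse.intro[OF subgroup_H])
    show "whitehead_automorphism A a \<phi>"
      using phi by (simp add: ascari_automorphism_def)
  qed (rule bspec[OF conjunct2[OF conjunct2[OF conjunct2[OF phi[unfolded ascari_automorphism_def]]]]])
  have aut: "aut H = nonbacktracking_automaton (ext_edges H) H"
    by (rule aut_eq[OF subgroup_H])
  have states: "states (aut H) = edge_states (ext_edges H)"
    by (simp add: aut nonbacktracking_automaton_def)
  have S': "S = edge_states C"
    by (simp add: S edge_states_C)
  \<comment> \<open>An infinite set has cardinality 0, so the strict inequality between the numbers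
    of edges forces this set to be finite.\<close>
  have "finite (edges (core H))"
    using phi by (intro card_ge_0_finite) (auto simp: ascari_automorphism_def)
  then have fin: "finite (edge_states (ext_edges H))"
    by (simp add: ext_edges_def extended_core_def finite_edge_states finite_sym_edges)
  have sub: "S \<subseteq> edge_states (ext_edges H)"
    using C_subset unfolding S' edge_states_def by blast
  have entries: "adjacency_matrix (aut H) ps $$ (i, k) = 1"
    if "i < dim_row (adjacency_matrix (aut H) ps)" "k < dim_col (adjacency_matrix (aut H) ps)"
      "adjacency_matrix (aut H) ps $$ (i, k) \<noteq> 0" for ps i k
    using that by (auto simp: adjacency_matrix_eq indexed_mat_def aut edge_count_aut)
  have elim: "eliminate ts (qs @ ss) (adjacency_matrix (aut H) (qs @ ss)) = adjacency_matrix B qs"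
    if "distinct qs" "set qs = Q" "distinct ss" "set ss = S" "distinct ts" "set ts = S" for qs ss ts
    unfolding B aut S' using that Q states S' finite_subset[OF sub fin]
    by (intro eliminate_collapse) auto
  have iso: "automaton_iso B (aut K)"
    unfolding B S by (rule collapse_iso_aut_K)
  \<comment> \<open>\<open>K\<close> is the image of \<open>H\<close> if the root is of the first
    kind, as the standing assumption on the image guarantees, and the conjugate of the image
    otherwise.\<close>
  show ?thesis
    using fin sub states elim iso standing_assumption_kind1 K_kind1 K_not_kind1 entries
    by auto
qed

end
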